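(* Let $p$ be prime, $n\ge1$, and let $T$ be a nice triangulation. Let $\lambda=(\lambda_1,\lambda_2):V(T)\to\mathbb{Z}_p\times[n]$ be a labeling of the vertices of $T$ such that for every vertex $\mathbf{x}$ of $T$ lying on the boundary, $\lambda(\theta\mathbf{x})=(\lambda_1(\mathbf{x})+1,\lambda_2(\mathbf{x}))$. Then there exists a $(p-1)$-simplex $\sigma$ of $T$ and $j\in[n]$ such that $\{\lambda(\mathbf{x}):\mathbf{x}\text{ a vertex of }\sigma\}=\mathbb{Z}_p\times\{j\}$.
   Context: Let $P=\{(\mathbf{v}_1,\dots,\mathbf{v}_p)\in(\mathbb{R}^n)^p:\sum_i\mathbf{v}_i=\mathbf{0}\}$ and $\theta(\mathbf{v}_1,\dots,\mathbf{v}_p)=(\mathbf{v}_p,\mathbf{v}_1,\dots,\mathbf{v}_{p-1})$. For $(i,j)\in\mathbb{Z}_p\times[n]$ (identify $\mathbb{Z}_p$ with $[p]$) let $\mathbf{e}^{i,j}=\frac{1}{2(p-1)}(-\mathbf{e}_j,\dots,-\mathbf{e}_j,(p-1)\mathbf{e}_j,-\mathbf{e}_j,\dots,-\mathbf{e}_j)\in P$ with $(p-1)\mathbf{e}_j$ in the $i$-th block, $\mathbf{e}_j$ the $j$-th unit vector of $\mathbb{R}^n$. For $\mathbf{s}\in[p]^n$ let $\sigma_{\mathbf{s}}=\mathrm{conv}(\{\mathbf{0}\}\cup\{\mathbf{e}^{i,j}: j\in[n], i\in\mathbb{Z}_p\setminus\{s_j\}\})$, and let $T^*$ be the simplicial complex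 of all faces of all $\sigma_{\mathbf{s}}$; its union is $Q=\mathrm{conv}\{\mathbf{e}^{i,j}\}$, a polytope in $P$ homeomorphic to the unit ball of $P$ and invariant under $\theta$ (with $\theta\mathbf{e}^{i,j}=\mathbf{e}^{i+1,j}$). A triangulation $T$ of $Q$ is nice if it refines $T^*$ (every simplex of $T$ lies in a simplex of $T^*$) and for every simplex $\sigma$ of $T$ contained in the relative boundary $\partial Q$, $\theta\sigma$ is also a simplex of $T$. "Boundary" vertices are those in $\partial Q$. *)

theory Defs
  imports "HOL-Analysis.Analysis" "Berlekamp_Zassenhaus.Finite_Field"
begin

text \<open>
  The space \<open>(\<real>\<^sup>n)\<^sup>p\<close> is the type \<^typ>\<open>real^'n^('p mod_ring)\<close> with \<open>n = CARD('n)\<close> and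
  \<open>p = CARD('p)\<close>: the \<open>p\<close> blocks are indexed by the ring \<open>\<int>\<^sub>p\<close>, the \<open>p\<close>-th block having
  index \<open>0\<close>.
\<close>

definition shift :: "real^'n^('p::nontriv mod_ring) \<Rightarrow> real^'n^('p mod_ring)" where
  "shift v = (\<chi> k. v $ (k - 1))"

definition evec :: "'p::nontriv mod_ring \<Rightarrow> 'n::finite \<Rightarrow> real^'n^('p mod_ring)" where
  "evec i j = (1 / (2 * (real CARD('p) - 1))) *\<^sub>R
     (\<chi> k. if k = i then (real CARD('p) - 1) *\<^sub>R axis j 1 else - axis j 1)"

lemma shift_evec: "shift (evec i j) = evec (i + 1) j"
  by (simp add: shift_def evec_def vec_eq_iff diff_eq_eq)

lemma sum_blocks_evec: "(\<Sum>k\<in>UNIV. evec i j $ k) = 0"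
  for i :: "'p::nontriv mod_ring" and j :: "'n::finite"
proof -
  have "card (UNIV - {i}) = CARD('p) - 1"
    by (simp add: card_Diff_singleton)
  moreover have "CARD('p) > 1"
    by (rule nontriv)
  ultimately have "(\<Sum>k\<in>UNIV - {i}. if k = i then (real CARD('p) - 1) *\<^sub>R axis j 1 else - axis j 1)
      = - ((real CARD('p) - 1) *\<^sub>R (axis j 1 :: real^'n))"
    by (simp add: sum_negf sum_constant_scaleR of_nat_diff del: sum_constant)
  then have "(\<Sum>k\<in>UNIV. if k = i then (real CARD('p) - 1) *\<^sub>R axis j 1 else - axis j 1)
      = (0 :: real^'n)"
    by (subst sum.remove[of _ i]) auto
  then show ?thesis
    by (simp add: evec_def flip: scaleR_sum_right)
qed

definition star_cell :: "('n \<Rightarrow> 'p mod_ring) \<Rightarrow> (real^'n^('p::nontriv mod_ring)) set" where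
  "star_cell s = convex hull ({0} \<union> {evec i j | i j. i \<noteq> s j})"

definition star_complex :: "(real^'n^('p::nontriv mod_ring)) set set" where
  "star_complex = {F. \<exists>s. F face_of star_cell s}"

definition Qpoly :: "(real^'n^('p::nontriv mod_ring)) set" where
  "Qpoly = convex hull {evec i j | i j. True}"

text \<open>
  A triangulation of a polytope is a (finite) geometric simplicial complex with that polytope as
  its union. The library's \<^const>\<open>triangulation\<close> is weaker than \<^const>\<open>simplicial_complex\<close>, as it
  does not demand closure under faces. A \<^const>\<open>simplicial_complex\<close> contains the empty face, a
  simplex of dimension \<open>-1\<close>.
\<close>

definition nice_triangulation :: "(real^'n^('p::nontriv mod_ring)) set set \<Rightarrow> bool" where
  "nice_triangulation T \<longleftrightarrow>
     simplicial_complex T \<and> \<Union>T = Qpoly \<and>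
     (\<forall>\<sigma>\<in>T. \<exists>\<tau>\<in>star_complex. \<sigma> \<subseteq> \<tau>) \<and>
     (\<forall>\<sigma>\<in>T. \<sigma> \<subseteq> rel_frontier Qpoly \<longrightarrow> shift ` \<sigma> \<in> T)"

definition vertices :: "'a::real_vector set \<Rightarrow> 'a set" where
  "vertices \<sigma> = {x. x extreme_point_of \<sigma>}"

end

theory Submission
  imports Defs
begin

text \<open>
  Suppose that no simplex of \<open>T\<close> carries all labels of some \<open>\<int>\<^sub>p \<times> {j}\<close>. To a point of \<open>Q\<close> attach
  the labels of those vertices of \<open>T\<close> whose open star contains a ball of fixed radius around the
  point. Over a sufficiently small simplex these label sets unite to a set without full fibre
  \<open>\<int>\<^sub>p \<times> {j}\<close>, hence of at most \<open>N = n (p - 1)\<close> elements, and on the boundary they are equivariant.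

  With coefficients in \<open>\<int>\<^sub>p\<close>, build chains \<open>h\<^sub>0, \<dots>, h\<^sub>N\<^sub>-\<^sub>1\<close> in the boundary of \<open>Q\<close> by iterated cones, with
  boundaries given alternately by \<open>t - 1\<close> and by the norm \<open>1 + t + \<dots> + t\<^sup>p\<^sup>-\<^sup>1\<close>, and cochains \<open>a\<^sub>k\<close> on
  lists over \<open>\<int>\<^sub>p \<times> \<nat>\<close> satisfying the dual relations. Subdivide finely and replace each face of a
  small simplex by its label set, recorded as an element of \<open>\<int>\<^sub>p\<close> and a cardinality. By the
  relations the value of \<open>a\<^sub>k\<close> on the image of the norm of \<open>h\<^sub>k\<close> does not depend on \<open>k\<close>, and it is
  \<open>1\<close> for \<open>k = 0\<close>. But the norm of \<open>h\<^sub>N\<^sub>-\<^sub>1\<close> is a cycle, so it bounds its cone from the centre of \<open>Q\<close>,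
  and the image of that cone is degenerate, having only \<open>N\<close> possible cardinalities for \<open>N + 1\<close>
  vertices. Thus the value for \<open>k = N - 1\<close> is \<open>0\<close>.
\<close>

section \<open>Cochains on lists and subdivision\<close>

text \<open>
  A cochain is a function on vertex lists, the empty list being the augmentation. Writing
  \<open>x # xs\<close> as the cone over \<open>xs\<close>, the boundary of a cone is its base minus the cone over the
  boundary of the base; \<open>cob\<close> is the transpose of this rule.
\<close>

fun cob :: "('a list \<Rightarrow> 'r::comm_ring_1) \<Rightarrow> 'a list \<Rightarrow> 'r" where
  "cob f [] = 0"
| "cob f (x # xs) = f xs - cob (\<lambda>ys. f (x # ys)) xs"

lemma cob_cong:
  assumes "\<And>ys. set ys \<subseteq> set xs \<Longrightarrow> Suc (length ys) = length xs \<Longrightarrow> f ys = g ys"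
  shows "cob f xs = cob g xs"
  using assms
proof (induction xs arbitrary: f g)
  case (Cons x xs)
  have "cob (\<lambda>ys. f (x # ys)) xs = cob (\<lambda>ys. g (x # ys)) xs"
    by (rule Cons.IH) (rule Cons.prems, auto)
  moreover have "f xs = g xs"
    by (rule Cons.prems) auto
  ultimately show ?case by simp
qed simp

lemma cob_zero: "cob (\<lambda>_. 0) xs = 0"
  by (induction xs) auto

lemma cob_diff: "cob (\<lambda>ys. f ys - g ys) xs = cob f xs - cob g xs"
  by (induction xs arbitrary: f g) (auto simp: algebra_simps)

lemma cob_sum: "cob (\<lambda>ys. \<Sum>i\<in>A. f i ys) xs = (\<Sum>i\<in>A. cob (f i) xs)"
  by (induction xs arbitrary: f) (auto simp: sum_subtractf)

lemma cob_map: "cob f (map g xs) = cob (\<lambda>ys. f (map g ys)) xs"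
  by (induction xs arbitrary: f) auto

lemma cob_cob: "cob (cob f) xs = 0"
  by (induction xs arbitrary: f) (auto simp: cob_diff)

text \<open>The two faces omitting one copy of \<open>v\<close> coincide and occur with opposite
  signs; every other face keeps the repetition, where \<open>f\<close> vanishes.\<close>

lemma cob_adjacent_eq:
  assumes "\<And>us v ws. Suc (length us + length ws) = n \<Longrightarrow> f (us @ v # v # ws) = 0"
    and "length us + length ws = n"
  shows "cob f (us @ v # v # ws) = 0"
  using assms
proof (induction us arbitrary: f n)
  case Nil
  have "cob (\<lambda>ys. f (v # v # ys)) ws = cob (\<lambda>_. 0) ws"
    using Nil.prems(1)[where us = "[]"] Nil.prems(2) by (intro cob_cong) auto
  then show ?case by (simp add: cob_zero)
next
  case (Cons u us)
  have "cob (\<lambda>ys. f (u # ys)) (us @ v # v # ws) = 0"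
  proof (rule Cons.IH)
    show "f (u # us' @ v # v # ws') = 0" if "Suc (length us' + length ws') = length us + length ws"
      for us' v ws'
      using Cons.prems(1)[of "u # us'" ws' v] Cons.prems(2) that by simp
  qed simp
  moreover have "f (us @ v # v # ws) = 0"
    using Cons.prems by simp
  ultimately show ?case by simp
qed

text \<open>
  \<open>sd b f xs\<close> is the value of the cochain \<open>f\<close> on the barycentric subdivision of the simplex \<open>xs\<close>,
  where \<open>b ys\<close> is the point placed at the barycentre of the face \<open>ys\<close>: the subdivision of \<open>xs\<close> is
  the cone with apex \<open>b xs\<close> over the subdivided boundary. The argument \<open>n\<close> of \<open>sdn\<close> is the length
  of the list.
\<close>

primrec sdn :: "('a list \<Rightarrow> 'b) \<Rightarrow> nat \<Rightarrow> ('b list \<Rightarrow> 'r::comm_ring_1) \<Rightarrow> 'a list \<Rightarrow> 'r" where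
  "sdn b 0 f xs = f []"
| "sdn b (Suc n) f xs = cob (sdn b n (\<lambda>ys. f (b xs # ys))) xs"

definition sd :: "('a list \<Rightarrow> 'b) \<Rightarrow> ('b list \<Rightarrow> 'r::comm_ring_1) \<Rightarrow> 'a list \<Rightarrow> 'r" where
  "sd b f xs = sdn b (length xs) f xs"

lemma sd_Nil [simp]: "sd b f [] = f []"
  by (simp add: sd_def)

lemma sd_step: "xs \<noteq> [] \<Longrightarrow> sd b f xs = cob (sd b (\<lambda>ys. f (b xs # ys))) xs"
  by (cases xs) (auto simp: sd_def simp del: cob.simps intro!: cob_cong)

text \<open>Induction along flags: \<open>R\<close> descends to faces, and \<open>P xs zs\<close> is
  an invariant of the simplices \<open>zs\<close> subdividing \<open>xs\<close>, preserved when the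
  next barycentre is prepended.\<close>

lemma sd_cong:
  assumes "R xs" "P [] []"
    and R: "\<And>xs ys. R xs \<Longrightarrow> set ys \<subseteq> set xs \<Longrightarrow> Suc (length ys) = length xs \<Longrightarrow> R ys"
    and P: "\<And>xs ys zs. R xs \<Longrightarrow> set ys \<subseteq> set xs \<Longrightarrow> Suc (length ys) = length xs \<Longrightarrow> P ys zs
      \<Longrightarrow> P xs (b xs # zs)"
    and "\<And>zs. P xs zs \<Longrightarrow> f zs = g zs"
  shows "sd b f xs = sd b g xs"
  using assms(1,5)
proof (induction xs arbitrary: f g rule: length_induct)
  case (1 xs)
  show ?case
  proof (cases "xs = []")
    case False
    show ?thesis unfolding sd_step[OF False]
    proof (rule cob_cong)
      fix ys assume ys: "set ys \<subseteq> set xs" "Suc (length ys) = length xs"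
      then have "length ys < length xs" "R ys" using R 1 by auto
      moreover have "f (b xs # zs) = g (b xs # zs)" if "P ys zs" for zs
        using P[OF "1.prems"(1) ys that] "1.prems" by blast
      ultimately show "sd b (\<lambda>ys. f (b xs # ys)) ys = sd b (\<lambda>ys. g (b xs # ys)) ys"
        using "1.IH" by (metis (no_types, lifting))
    qed
  qed (use 1 assms in auto)
qed

lemma sd_diff: "sd b (\<lambda>ys. f ys - g ys) xs = sd b f xs - sd b g xs"
proof (induction xs arbitrary: f g rule: length_induct)
  case (1 xs)
  show ?case
  proof (cases "xs = []")
    case False
    show ?thesis unfolding sd_step[OF False] cob_diff[symmetric]
      by (rule cob_cong) (use 1 in auto)
  qed simp
qed

lemma sd_sum: "sd b (\<lambda>ys. \<Sum>i\<in>A. f i ys) xs = (\<Sum>i\<in>A. sd b (f i) xs)"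
proof (induction xs arbitrary: f rule: length_induct)
  case (1 xs)
  show ?case
  proof (cases "xs = []")
    case False
    show ?thesis unfolding sd_step[OF False] cob_sum[symmetric]
      by (rule cob_cong) (use 1 in auto)
  qed simp
qed

text \<open>Subdivision is a chain map: a cone with apex \<open>b xs\<close> has as boundary its
  base minus a cone over the boundary of the base, and the base is a cycle by induction and
  \<open>cob_cob\<close>.\<close>

lemma cob_sd: "cob (sd b f) xs = sd b (cob f) xs"
proof (induction xs arbitrary: f rule: length_induct)
  case (1 xs)
  show ?case
  proof (cases "xs = []")
    case False
    let ?g = "\<lambda>ys. f (b xs # ys)"
    have "cob (sd b (cob ?g)) xs = cob (cob (sd b ?g)) xs"
      by (rule cob_cong) (use 1 in auto)
    moreover have "sd b (\<lambda>ys. f ys - cob ?g ys) = (\<lambda>ys. sd b f ys - sd b (cob ?g) ys)"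
      by (rule ext) (rule sd_diff)
    ultimately show ?thesis
      by (simp add: sd_step[OF False] cob_diff cob_cob)
  qed simp
qed

lemma sd_map:
  assumes "R xs"
    and "\<And>xs ys. R xs \<Longrightarrow> set ys \<subseteq> set xs \<Longrightarrow> Suc (length ys) = length xs \<Longrightarrow> R ys"
    and "\<And>xs. R xs \<Longrightarrow> xs \<noteq> [] \<Longrightarrow> b (map g xs) = h (b xs)"
  shows "sd b f (map g xs) = sd b (\<lambda>ys. f (map h ys)) xs"
  using assms(1)
proof (induction xs arbitrary: f rule: length_induct)
  case (1 xs)
  show ?case
  proof (cases "xs = []")
    case False
    then have "map g xs \<noteq> []" by simp
    then show ?thesis unfolding sd_step[OF False] sd_step[OF \<open>map g xs \<noteq> []\<close>] cob_map
      by (intro cob_cong) (use 1 assms False in \<open>auto simp: assms(3)\<close>)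
  qed simp
qed

section \<open>The universal equivariant cochain\<close>

definition tr :: "'p::nontriv mod_ring \<Rightarrow> 'p mod_ring \<times> 'b \<Rightarrow> 'p mod_ring \<times> 'b" where
  "tr g x = (fst x + g, snd x)"

lemma fst_tr [simp]: "fst (tr g x) = fst x + g" and snd_tr [simp]: "snd (tr g x) = snd x"
  by (simp_all add: tr_def)

lemma tr_0 [simp]: "tr 0 = (\<lambda>x. x)"
  by (rule ext) (simp add: tr_def)

lemma tr_tr [simp]: "tr g (tr h x) = tr (h + g) x"
  by (simp add: tr_def add.assoc)

lemma tr_comp_tr [simp]: "tr g \<circ> tr h = tr (h + g)"
  by (rule ext) simp

lemma map_tr_tr: "map (tr g) (map (tr h) xs) = map (tr (h + g)) xs"
  by simp

definition norm_tr ::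
  "(('p::nontriv mod_ring \<times> 'b) list \<Rightarrow> 'r::comm_ring_1) \<Rightarrow> ('p mod_ring \<times> 'b) list \<Rightarrow> 'r" where
  "norm_tr f xs = (\<Sum>g\<in>UNIV. f (map (tr g) xs))"

lemma sum_translate: "(\<Sum>g\<in>UNIV. f (h + g)) = (\<Sum>g\<in>UNIV. f g)" for h :: "'p::nontriv mod_ring"
  by (rule sum.reindex_bij_witness[where i = "\<lambda>g. g - h" and j = "\<lambda>g. h + g"]) auto

lemma norm_tr_map_tr: "norm_tr f (map (tr h) xs) = norm_tr f xs"
  unfolding norm_tr_def map_tr_tr by (rule sum_translate)

lemma cob_norm_tr: "cob (norm_tr f) xs = norm_tr (cob f) xs"
  unfolding norm_tr_def cob_map by (rule cob_sum)

lemma norm_tr_diff: "norm_tr (\<lambda>ys. f ys - g ys) xs = norm_tr f xs - norm_tr g xs"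
  by (simp add: norm_tr_def sum_subtractf)

definition nat_rep :: "'p::nontriv mod_ring \<Rightarrow> nat" where
  "nat_rep g = nat (to_int_mod_ring g)"

lemma of_nat_nat_rep [simp]: "of_nat (nat_rep g) = g"
  unfolding nat_rep_def of_nat_of_int_mod_ring o_def
  by (subst nat_0_le) (transfer, simp, simp)

lemma nat_rep_less: "nat_rep (g :: 'p::nontriv mod_ring) < CARD('p)"
  unfolding nat_rep_def by transfer auto

lemma nat_rep_of_nat: "k < CARD('p) \<Longrightarrow> nat_rep (of_nat k :: 'p::nontriv mod_ring) = k"
  by (simp add: nat_rep_def of_nat_of_int_mod_ring)

lemma nat_rep_add_1:
  fixes g :: "'p::nontriv mod_ring"
  shows "nat_rep (g + 1) = (if Suc (nat_rep g) = CARD('p) then 0 else Suc (nat_rep g))"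
proof -
  have eq: "g + 1 = of_nat (Suc (nat_rep g))" by simp
  show ?thesis
  proof (cases "Suc (nat_rep g) = CARD('p)")
    case True
    then have "g + 1 = of_nat 0" unfolding eq by (metis of_nat_0 of_nat_card_eq_0)
    then show ?thesis using True nat_rep_of_nat[of 0, where 'p='p] by (metis of_nat_0 zero_less_card_finite)
  next
    case False
    then show ?thesis using nat_rep_less[of g] unfolding eq by (subst nat_rep_of_nat) auto
  qed
qed

lemma sum_UNIV_mod_ring: "(\<Sum>g\<in>UNIV. f (g :: 'p::nontriv mod_ring)) = (\<Sum>k<CARD('p). f (of_nat k))"
  by (rule sum.reindex_bij_witness[where i = of_nat and j = nat_rep])
     (auto simp: nat_rep_less nat_rep_of_nat)

text \<open>
  On lists of odd length the norm of \<open>univ_cochain\<close> is its coboundary, on nonempty lists of even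
  length the difference under the generator is. Both equations can be solved for the next degree
  because \<open>\<int>\<^sub>p\<close> acts freely on nonempty lists, the first component of the head being a coordinate
  on each orbit.
\<close>

primrec univn :: "nat \<Rightarrow> ('p::nontriv mod_ring \<times> 'b) list \<Rightarrow> 'r::comm_ring_1" where
  "univn 0 xs = 1"
| "univn (Suc n) xs =
    (if even n then if fst (hd xs) = 0 then cob (univn n) xs else 0
     else \<Sum>m<nat_rep (fst (hd xs)). cob (univn n) (map (tr (of_nat m - fst (hd xs))) xs))"

definition univ_cochain :: "('p::nontriv mod_ring \<times> 'b) list \<Rightarrow> 'r::comm_ring_1" where
  "univ_cochain xs = univn (length xs) xs"

lemma univ_cochain_Nil [simp]: "univ_cochain [] = 1"
  by (simp add: univ_cochain_def)

lemma cob_univn: "length xs = Suc n \<Longrightarrow> cob (univn n) xs = cob univ_cochain xs"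
  by (rule cob_cong) (auto simp: univ_cochain_def)

lemma univ_cochain_odd:
  "odd (length xs) \<Longrightarrow> univ_cochain xs = (if fst (hd xs) = 0 then cob univ_cochain xs else 0)"
  by (cases xs) (auto simp: univ_cochain_def[of "_ # _"] cob_univn simp del: cob.simps)

lemma univ_cochain_even:
  assumes "even (length xs)" "xs \<noteq> []"
  shows "univ_cochain xs =
    (\<Sum>m<nat_rep (fst (hd xs)). cob univ_cochain (map (tr (of_nat m - fst (hd xs))) xs))"
proof -
  obtain n where n: "length xs = Suc n" using assms(2) by (cases xs) auto
  then show ?thesis using assms by (simp add: univ_cochain_def[of xs] cob_univn)
qed

lemma fst_hd_map_tr: "xs \<noteq> [] \<Longrightarrow> fst (hd (map (tr g) xs)) = fst (hd xs) + g"
  by (cases xs) auto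

lemma univ_cochain_equivariance:
  fixes xs :: "('p::nontriv mod_ring \<times> 'b) list"
  shows "(odd (length xs) \<longrightarrow> norm_tr univ_cochain xs = (cob univ_cochain xs :: 'r::comm_ring_1)) \<and>
    (even (length xs) \<longrightarrow> xs \<noteq> [] \<longrightarrow>
      univ_cochain (map (tr 1) xs) - univ_cochain xs = (cob univ_cochain xs :: 'r))"
proof (induction xs rule: length_induct)
  case (1 xs)
  show ?case
  proof (cases "xs = []")
    case False
    let ?a = "univ_cochain :: ('p mod_ring \<times> 'b) list \<Rightarrow> 'r"
    let ?b = "cob ?a" and ?g = "fst (hd xs)"
    show ?thesis
    proof (intro conjI impI)
      assume odd: "odd (length xs)"
      have inv: "?b (map (tr 1) ys) = ?b ys" if "length ys = length xs" for ys
      \<comment> \<open>The even equation excludes the empty list, so single vertices are treated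
        apart; there \<open>?b\<close> is \<open>1\<close>.\<close>
      proof (cases "length ys = 1")
        case True
        then obtain y where "ys = [y]" by (auto simp: length_Suc_conv)
        then show ?thesis by simp
      next
        case False
        have "?b (map (tr 1) ys) - ?b ys = cob (\<lambda>zs. ?a (map (tr 1) zs) - ?a zs) ys"
          by (simp add: cob_diff cob_map)
        also have "\<dots> = cob ?b ys"
        proof (rule cob_cong)
          fix zs assume "set zs \<subseteq> set ys" and *: "Suc (length zs) = length ys"
          moreover have "zs \<noteq> []" using * False by auto
          moreover have "even (length zs)" using * odd that by (metis even_Suc)
          ultimately show "?a (map (tr 1) zs) - ?a zs = ?b zs"
            using 1 that by auto
        qed
        finally show ?thesis by (simp add: cob_cob)
      qed
      have inv': "?b (map (tr (of_nat k)) xs) = ?b xs" for k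
      proof (induction k)
        case (Suc k)
        have "?b (map (tr (of_nat (Suc k))) xs) = ?b (map (tr 1) (map (tr (of_nat k)) xs))"
          by (simp add: add.commute)
        then show ?case using Suc inv[of "map (tr (of_nat k)) xs"] by simp
      qed simp
      have "norm_tr ?a xs = (\<Sum>g\<in>UNIV. if g = - ?g then ?b xs else 0)"
        unfolding norm_tr_def
      proof (rule sum.cong)
        fix g :: "'p mod_ring"
        have "?b (map (tr g) xs) = ?b xs" using inv'[of "nat_rep g"] by simp
        then show "?a (map (tr g) xs) = (if g = - ?g then ?b xs else 0)"
          using odd by (subst univ_cochain_odd)
            (auto simp: fst_hd_map_tr[OF False] add_eq_0_iff simp del: map_map)
      qed simp
      then show "norm_tr ?a xs = ?b xs" by simp
    next
      assume even: "even (length xs)"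
      have "norm_tr ?b xs = cob (norm_tr ?a) xs" by (simp add: cob_norm_tr)
      also have "\<dots> = cob ?b xs"
        using 1 even by (intro cob_cong) (metis even_Suc lessI)
      finally have norm: "norm_tr ?b xs = 0" by (simp add: cob_cob)
      let ?f = "\<lambda>g. ?b (map (tr g) xs)"
      \<comment> \<open>Translation by \<open>1\<close> adds one summand and keeps the others,
        unless the residue wraps to \<open>0\<close>; in that case \<open>norm\<close> makes the sum
        over the whole orbit vanish.\<close>
      have a1: "?a (map (tr 1) xs) = (\<Sum>m<nat_rep (?g + 1). ?f (of_nat m - ?g))"
        using even False by (subst univ_cochain_even)
          (simp_all only: fst_hd_map_tr[OF False] map_tr_tr length_map map_is_Nil_conv
              diff_add_eq_diff_diff_swap add_diff_eq add_diff_cancel_left' if_True, simp_all add: algebra_simps)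
      have a0: "?a xs = (\<Sum>m<nat_rep ?g. ?f (of_nat m - ?g))"
        by (rule univ_cochain_even[OF even False])
      have last: "?f (of_nat (nat_rep ?g) - ?g) = ?b xs" by simp
      show "?a (map (tr 1) xs) - ?a xs = ?b xs"
      proof (cases "Suc (nat_rep ?g) = CARD('p)")
        case True
        have "(\<Sum>m<CARD('p). ?f (of_nat m - ?g)) = (\<Sum>g\<in>UNIV. ?f (- ?g + g))"
          by (simp add: sum_UNIV_mod_ring)
        also have "\<dots> = 0"
          using norm unfolding norm_tr_def by (subst sum_translate)
        finally have "?a xs + ?b xs = 0"
          unfolding a0 True[symmetric] using last by simp
        moreover have "?a (map (tr 1) xs) = 0"
          unfolding a1 by (simp add: nat_rep_add_1 True)
        ultimately show ?thesis by (simp add: add_eq_0_iff)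
      next
        case False
        then show ?thesis unfolding a1 a0 nat_rep_add_1 using last by simp
      qed
    qed
  qed simp
qed

text \<open>Joint induction: \<open>univ_cochain\<close> is built from its coboundary on translates,
  which keep the repetition, and \<open>cob_adjacent_eq\<close> reduces the coboundary to shorter
  lists.\<close>

lemma cob_univ_cochain_adjacent_eq:
  fixes v :: "'p::nontriv mod_ring \<times> 'b"
  shows "cob univ_cochain (us @ v # v # ws) = (0 :: 'r::comm_ring_1)"
proof -
  have "univ_cochain (us @ v # v # ws) = (0 :: 'r) \<and> cob univ_cochain (us @ v # v # ws) = (0 :: 'r)"
  proof (induction "length us + length ws" arbitrary: us v ws rule: less_induct)
    case less
    have b: "cob univ_cochain (us' @ v # v # ws') = (0 :: 'r)"
      if "length us' + length ws' = length us + length ws" for us' ws' and v :: "'p mod_ring \<times> 'b"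
      by (rule cob_adjacent_eq[OF _ that]) (use less in auto)
    have "univ_cochain (us @ v # v # ws) = (0 :: 'r)"
    proof (cases "odd (length (us @ v # v # ws))")
      case True
      then show ?thesis using b by (subst univ_cochain_odd) auto
    next
      case False
      then show ?thesis using b by (subst univ_cochain_even) (auto simp del: cob.simps)
    qed
    then show ?case by (simp add: b)
  qed
  then show ?thesis by simp
qed

section \<open>The chain of iterated cones\<close>

definition step_op :: "nat \<Rightarrow> (('p::nontriv mod_ring \<times> 'b) list \<Rightarrow> 'r::comm_ring_1)
    \<Rightarrow> ('p mod_ring \<times> 'b) list \<Rightarrow> 'r" where
  "step_op k f ys = (if even k then f (map (tr 1) ys) - f ys else norm_tr f ys)"

lemma step_op_cob: "step_op k (cob f) ys = cob (step_op k f) ys"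
  by (simp add: step_op_def[abs_def] cob_diff cob_map cob_norm_tr)

lemma step_op_diff: "step_op k (\<lambda>ys. f ys - g ys) ys = step_op k f ys - step_op k g ys"
  by (simp add: step_op_def norm_tr_diff)

lemma step_op_sum: "step_op k (\<lambda>ys. \<Sum>i\<in>A. f i ys) ys = (\<Sum>i\<in>A. step_op k (f i) ys)"
  by (auto simp: step_op_def norm_tr_def sum_subtractf intro: sum.swap)

lemma norm_tr_translate: "norm_tr (\<lambda>zs. f (map (tr h) zs)) ys = norm_tr f ys"
  using sum_translate[of "\<lambda>g. f (map (tr g) ys)" h] by (simp add: norm_tr_def add.commute)

text \<open>A norm is invariant, so its difference is \<open>0\<close> and its own norm is
  \<open>p\<close> times itself, hence \<open>0\<close> with coefficients in
  \<open>'p mod_ring\<close>.\<close>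

lemma step_op_norm_tr:
  fixes f :: "('p::nontriv mod_ring \<times> 'b) list \<Rightarrow> 'p mod_ring"
  shows "step_op k (norm_tr f) ys = 0"
  by (simp add: step_op_def norm_tr_map_tr) (simp add: norm_tr_def[of "norm_tr f"] norm_tr_map_tr)

lemma step_op_step_op:
  fixes f :: "('p::nontriv mod_ring \<times> 'b) list \<Rightarrow> 'p mod_ring"
  shows "step_op k (step_op (Suc k) f) ys = 0"
proof (cases "even k")
  case True
  then have "step_op (Suc k) f = norm_tr f"
    by (intro ext) (simp add: step_op_def)
  then show ?thesis by (simp add: step_op_norm_tr)
next
  case False
  then show ?thesis
    by (simp add: step_op_def[abs_def] norm_tr_diff norm_tr_translate)
qed

text \<open>
  \<open>join_chain jj k\<close> is integration over a \<open>k\<close>-chain \<open>h\<^sub>k\<close> in the simplex on \<open>\<int>\<^sub>p \<times> [n]\<close>, where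
  \<open>h\<^sub>k\<^sub>+\<^sub>1\<close> is the cone with apex \<open>(0, jj (k + 1))\<close> over \<open>(t - 1) h\<^sub>k\<close> for even \<open>k\<close> and over
  \<open>(1 + t + \<dots> + t\<^sup>p\<^sup>-\<^sup>1) h\<^sub>k\<close> for odd \<open>k\<close>, \<open>t\<close> being the generator of \<open>\<int>\<^sub>p\<close>. The base of each cone
  is a cycle since \<open>(t - 1) (1 + t + \<dots> + t\<^sup>p\<^sup>-\<^sup>1) = 0\<close>.
\<close>

primrec join_chain :: "(nat \<Rightarrow> 'b) \<Rightarrow> nat \<Rightarrow> (('p::nontriv mod_ring \<times> 'b) list \<Rightarrow> 'r::comm_ring_1) \<Rightarrow> 'r" where
  "join_chain jj 0 f = f [(0, jj 0)]"
| "join_chain jj (Suc k) f = join_chain jj k (step_op k (\<lambda>zs. f ((0, jj (Suc k)) # zs)))"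

text \<open>Each new apex comes first and translations change only first components, so every
  simplex of \<open>h_k\<close> has second components \<open>jj k, ..., jj 0\<close>.\<close>

lemma join_chain_cong:
  assumes "\<And>ys. map snd ys = rev (map jj [0..<Suc k]) \<Longrightarrow> f ys = g ys"
  shows "join_chain jj k f = join_chain jj k g"
  using assms
proof (induction k arbitrary: f g)
  case (Suc k)
  show ?case unfolding join_chain.simps
  proof (rule Suc.IH)
    fix ys :: "('a mod_ring \<times> 'b) list" assume "map snd ys = rev (map jj [0..<Suc k])"
    then have "f ((0, jj (Suc k)) # map (tr h) ys) = g ((0, jj (Suc k)) # map (tr h) ys)" for h
      by (intro Suc.prems) (simp add: o_def)
    from this this[of 0] show "step_op k (\<lambda>zs. f ((0, jj (Suc k)) # zs)) ys
        = step_op k (\<lambda>zs. g ((0, jj (Suc k)) # zs)) ys"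
      by (simp add: step_op_def norm_tr_def)
  qed
qed simp

lemma join_chain_diff: "join_chain jj k (\<lambda>ys. f ys - g ys) = join_chain jj k f - join_chain jj k g"
  by (induction k arbitrary: f g) (simp_all add: step_op_diff[abs_def])

lemma join_chain_sum: "join_chain jj k (\<lambda>ys. \<Sum>i\<in>A. f i ys) = (\<Sum>i\<in>A. join_chain jj k (f i))"
  by (induction k arbitrary: f) (simp_all add: step_op_sum[abs_def])

lemma join_chain_zero: "join_chain jj k (\<lambda>_. 0) = 0"
  using join_chain_diff[of jj k "\<lambda>_. 0" "\<lambda>_. 0"] by simp

text \<open>Stokes for the cone \<open>h_(k+1)\<close>: its boundary is its base minus a cone over
  the boundary of the base, and that boundary vanishes by induction and
  \<open>step_op_step_op\<close>.\<close>

lemma join_chain_Suc_cob: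
  fixes f :: "('p::nontriv mod_ring \<times> 'b) list \<Rightarrow> 'p mod_ring"
  shows "join_chain jj (Suc k) (cob f) = join_chain jj k (step_op k f)"
proof (induction k arbitrary: f)
  case 0
  then show ?case by (simp add: step_op_def)
next
  case (Suc k)
  let ?g = "\<lambda>zs. f ((0, jj (Suc (Suc k))) # zs)"
  have "join_chain jj (Suc (Suc k)) (cob f) = join_chain jj (Suc k) (\<lambda>ys. step_op (Suc k) f ys - cob (step_op (Suc k) ?g) ys)"
    unfolding join_chain.simps(2)[of jj "Suc k"] by (simp add: step_op_diff[abs_def] step_op_cob del: join_chain.simps)
  also have "\<dots> = join_chain jj (Suc k) (step_op (Suc k) f) - join_chain jj k (step_op k (step_op (Suc k) ?g))"
    unfolding join_chain_diff Suc.IH ..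
  also have "join_chain jj k (step_op k (step_op (Suc k) ?g)) = 0"
    by (simp add: step_op_step_op[abs_def] join_chain_zero)
  finally show ?case by simp
qed

text \<open>The norm annihilates the boundary of \<open>h_k\<close>, which is itself a difference or
  a norm; for \<open>k = 0\<close> the augmentation counts \<open>p\<close> points.\<close>

lemma join_chain_cob_norm_tr:
  fixes f :: "('p::nontriv mod_ring \<times> 'b) list \<Rightarrow> 'p mod_ring"
  shows "join_chain jj k (cob (norm_tr f)) = 0"
proof (cases k)
  case 0
  then show ?thesis by (simp add: norm_tr_def)
next
  case (Suc k')
  then show ?thesis unfolding Suc join_chain_Suc_cob by (simp add: step_op_norm_tr[abs_def] join_chain_zero)
qed

text \<open>\<open>\<Phi>\<close> stands for pull-back along a chain map that is equivariant on the
  simplices of the \<open>h_k\<close>. The induction on \<open>k\<close> alternates the two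
  equations of \<open>univ_cochain_equivariance\<close>.\<close>

lemma join_chain_norm_tr_univ_cochain:
  fixes \<Phi> :: "(('p::nontriv mod_ring \<times> 'c) list \<Rightarrow> 'p mod_ring)
    \<Rightarrow> ('p mod_ring \<times> 'b) list \<Rightarrow> 'p mod_ring"
  assumes cong: "\<And>f g ys. (\<And>zs. length zs = length ys \<Longrightarrow> f zs = g zs) \<Longrightarrow> \<Phi> f ys = \<Phi> g ys"
    and diff: "\<And>f g ys. \<Phi> (\<lambda>zs. f zs - g zs) ys = \<Phi> f ys - \<Phi> g ys"
    and sum: "\<And>f ys. \<Phi> (\<lambda>zs. \<Sum>h\<in>UNIV. f (h :: 'p mod_ring) zs) ys = (\<Sum>h\<in>UNIV. \<Phi> (f h) ys)"
    and cob: "\<And>f ys. cob (\<Phi> f) ys = \<Phi> (cob f) ys"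
    and Nil: "\<And>f. \<Phi> f [] = f []"
    and tr1: "\<And>f ys k. map snd ys = rev (map jj [0..<Suc k]) \<Longrightarrow> k < N \<Longrightarrow>
      \<Phi> f (map (tr 1) ys) = \<Phi> (\<lambda>zs. f (map (tr 1) zs)) ys"
    and "k < N"
  shows "join_chain jj k (norm_tr (\<Phi> univ_cochain)) = 1"
proof -
  let ?a = "univ_cochain :: ('p mod_ring \<times> 'c) list \<Rightarrow> 'p mod_ring"
  have tr_nat: "\<Phi> f (map (tr (of_nat m)) ys) = \<Phi> (\<lambda>zs. f (map (tr (of_nat m)) zs)) ys"
    if "map snd ys = rev (map jj [0..<Suc k])" "k < N" for f ys k m
  proof (induction m arbitrary: f)
    case (Suc m)
    have "map snd (map (tr (of_nat m)) ys) = rev (map jj [0..<Suc k])"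
      using that(1) by (simp add: o_def)
    then have "\<Phi> f (map (tr 1) (map (tr (of_nat m)) ys)) =
        \<Phi> (\<lambda>zs. f (map (tr 1) (map (tr (of_nat m)) zs))) ys"
      using tr1[OF _ that(2), of "map (tr (of_nat m)) ys" f] Suc by (simp del: map_map)
    then show ?case by (simp add: add.commute)
  qed simp
  have tr: "\<Phi> f (map (tr h) ys) = \<Phi> (\<lambda>zs. f (map (tr h) zs)) ys"
    if "map snd ys = rev (map jj [0..<Suc k])" "k < N" for f ys k h
    using tr_nat[OF that, of f "nat_rep h"] by simp
  have norm: "norm_tr (\<Phi> f) ys = \<Phi> (norm_tr f) ys"
    if "map snd ys = rev (map jj [0..<Suc k])" "k < N" for f ys k
    unfolding norm_tr_def[abs_def] sum using tr[OF that] by simp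
  have odd: "join_chain jj k (norm_tr (\<Phi> ?a)) = join_chain jj k (cob (\<Phi> ?a))" if "k < N" "even k" for k
  proof (rule join_chain_cong)
    fix ys :: "('p mod_ring \<times> 'b) list" assume ys: "map snd ys = rev (map jj [0..<Suc k])"
    have "odd (length ys)" using arg_cong[OF ys, of length] that(2) by simp
    then have "\<Phi> (norm_tr ?a) ys = \<Phi> (cob ?a) ys"
      by (intro cong) (simp add: univ_cochain_equivariance)
    then show "norm_tr (\<Phi> ?a) ys = cob (\<Phi> ?a) ys"
      by (simp add: norm[OF ys that(1)] cob)
  qed
  show ?thesis using \<open>k < N\<close>
  proof (induction k)
    case 0
    then show ?case by (subst odd) (simp_all add: Nil)
  next
    case (Suc k)
    then have k: "k < N" and IH: "join_chain jj k (norm_tr (\<Phi> ?a)) = 1" by auto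
    show ?case
    proof (cases "even k")
      case False
      then have "step_op k (\<Phi> ?a) = norm_tr (\<Phi> ?a)"
        by (intro ext) (simp add: step_op_def)
      then show ?thesis using odd[OF Suc.prems] False IH by (simp add: join_chain_Suc_cob del: join_chain.simps)
    next
      case True
      \<comment> \<open>The norms are compared translate by translate: \<open>A\<close> and
        \<open>B\<close> have equal increments, so \<open>A - B\<close> is constant and its sum over
        \<open>p\<close> translates is \<open>0\<close>.\<close>
      define A where "A h = join_chain jj (Suc k) (\<lambda>ys. \<Phi> ?a (map (tr h) ys))" for h
      define B where "B h = join_chain jj k (\<lambda>ys. \<Phi> ?a (map (tr h) ys))" for h
      have AB: "A (h + 1) - A h = B (h + 1) - B h" for h
      proof -
        let ?f = "\<lambda>zs. ?a (map (tr h) zs)"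
        have "A (h + 1) - A h = join_chain jj (Suc k) (cob (\<Phi> ?f))"
          unfolding A_def join_chain_diff[symmetric]
        proof (rule join_chain_cong)
          fix ys :: "('p mod_ring \<times> 'b) list" assume ys: "map snd ys = rev (map jj [0..<Suc (Suc k)])"
          have len: "length ys = Suc (Suc k)" using arg_cong[OF ys, of length] by simp
          have "\<Phi> ?a (map (tr (h + 1)) ys) - \<Phi> ?a (map (tr h) ys) =
              \<Phi> (\<lambda>zs. ?a (map (tr (h + 1)) zs) - ?a (map (tr h) zs)) ys"
            by (simp only: tr[OF ys Suc.prems] diff)
          also have "\<dots> = \<Phi> (cob ?f) ys"
          proof (rule cong)
            fix zs :: "('p mod_ring \<times> 'c) list" assume "length zs = length ys"
            then have "?a (map (tr 1) (map (tr h) zs)) - ?a (map (tr h) zs) = cob ?a (map (tr h) zs)"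
              using univ_cochain_equivariance[of "map (tr h) zs", where 'r = "'p mod_ring"] len True
              by (auto simp del: map_map)
            then show "?a (map (tr (h + 1)) zs) - ?a (map (tr h) zs) = cob ?f zs"
              by (simp add: cob_map)
          qed
          finally show "\<Phi> ?a (map (tr (h + 1)) ys) - \<Phi> ?a (map (tr h) ys) = cob (\<Phi> ?f) ys"
            by (simp add: cob)
        qed
        also have "\<dots> = join_chain jj k (step_op k (\<Phi> ?f))" by (rule join_chain_Suc_cob)
        also have "\<dots> = B (h + 1) - B h"
          unfolding B_def join_chain_diff[symmetric]
        proof (rule join_chain_cong)
          fix ys :: "('p mod_ring \<times> 'b) list" assume ys: "map snd ys = rev (map jj [0..<Suc k])"
          have "map snd (map (tr 1) ys) = rev (map jj [0..<Suc k])" using ys by (simp add: o_def)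
          from tr[OF ys k, of ?a h] tr[OF this k, of ?a h]
          show "step_op k (\<Phi> ?f) ys = \<Phi> ?a (map (tr (h + 1)) ys) - \<Phi> ?a (map (tr h) ys)"
            using True by (simp add: step_op_def add.commute)
        qed
        finally show ?thesis .
      qed
      have const: "A (of_nat m) - B (of_nat m) = A 0 - B 0" for m
      proof (induction m)
        case (Suc m)
        have "A (of_nat (Suc m)) - B (of_nat (Suc m)) =
            (A (of_nat m + 1) - A (of_nat m)) - (B (of_nat m + 1) - B (of_nat m)) + (A (of_nat m) - B (of_nat m))"
          by (simp add: add.commute)
        then show ?case using Suc by (simp add: AB)
      qed simp
      have "A h - B h = A 0 - B 0" for h using const[of "nat_rep h"] by simp
      then have "(\<Sum>h\<in>UNIV. A h - B h) = (\<Sum>h\<in>(UNIV :: 'p mod_ring set). A 0 - B 0)"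
        by (intro sum.cong) auto
      then have "(\<Sum>h\<in>UNIV. A h) - (\<Sum>h\<in>UNIV. B h) = 0"
        by (simp add: sum_subtractf)
      moreover have "join_chain jj (Suc k) (norm_tr (\<Phi> ?a)) = (\<Sum>h\<in>UNIV. A h)"
        unfolding A_def norm_tr_def[abs_def] by (rule join_chain_sum)
      moreover have "join_chain jj k (norm_tr (\<Phi> ?a)) = (\<Sum>h\<in>UNIV. B h)"
        unfolding B_def norm_tr_def[abs_def] by (rule join_chain_sum)
      ultimately show ?thesis using IH by simp
    qed
  qed
qed

section \<open>Barycentric subdivision\<close>

definition bary :: "'a::real_normed_vector list \<Rightarrow> 'a" where
  "bary xs = (1 / real (length xs)) *\<^sub>R (\<Sum>i<length xs. xs ! i)"

lemma bary_in_convex_hull: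
  assumes "xs \<noteq> []"
  shows "bary xs \<in> convex hull set xs"
proof -
  have "(\<Sum>i<length xs. (1 / real (length xs)) *\<^sub>R xs ! i) \<in> convex hull set xs"
    using assms by (intro convex_sum) (auto intro: hull_inc)
  then show ?thesis by (simp add: bary_def scaleR_sum_right)
qed

lemma bary_map: "linear g \<Longrightarrow> bary (map g xs) = g (bary xs)"
  by (simp add: bary_def linear_scale linear_sum)

text \<open>Among the differences averaged in \<open>bary xs - v\<close>, the one for
  \<open>v\<close> itself is \<open>0\<close>; hence the factor \<open>(l - 1) / l\<close> at length
  \<open>l\<close>. Convexity of balls extends the bound to the hull.\<close>

lemma dist_bary_le:
  assumes D: "\<And>u v. u \<in> set xs \<Longrightarrow> v \<in> set xs \<Longrightarrow> dist u v \<le> D"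
    and y: "y \<in> convex hull set xs" and "length xs \<le> Suc n"
  shows "dist (bary xs) y \<le> (real n / real (Suc n)) * D"
proof -
  have ne: "xs \<noteq> []" using y by auto
  let ?l = "length xs"
  have D0: "0 \<le> D" using D[of "hd xs" "hd xs"] ne by simp
  have "set xs \<subseteq> cball (bary xs) ((real n / real (Suc n)) * D)"
  proof
    fix v assume "v \<in> set xs"
    then obtain j where j: "j < ?l" "v = xs ! j" by (auto simp: in_set_conv_nth)
    have "bary xs - v = (1 / real ?l) *\<^sub>R (\<Sum>i<?l. xs ! i - v)"
      using ne by (simp add: bary_def sum_subtractf sum_constant_scaleR scaleR_diff_right del: sum_constant)
    also have "(\<Sum>i<?l. xs ! i - v) = (\<Sum>i\<in>{..<?l} - {j}. xs ! i - v)"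
      using j by (subst sum.remove[of _ j]) auto
    finally have "dist (bary xs) v = (1 / real ?l) * norm (\<Sum>i\<in>{..<?l} - {j}. xs ! i - v)"
      by (simp add: dist_norm)
    also have "norm (\<Sum>i\<in>{..<?l} - {j}. xs ! i - v) \<le> (\<Sum>i\<in>{..<?l} - {j}. D)"
      by (rule sum_norm_le) (use D j in \<open>auto simp: dist_norm\<close>)
    also have "\<dots> = (real ?l - 1) * D"
      using j by (simp add: card_Diff_singleton of_nat_diff)
    finally have "dist (bary xs) v \<le> (1 / real ?l) * ((real ?l - 1) * D)"
      by (simp add: divide_right_mono)
    also have "\<dots> = ((real ?l - 1) / real ?l) * D" by simp
    also have "\<dots> \<le> (real n / real (Suc n)) * D"
    proof (rule mult_right_mono[OF _ D0])
      show "(real ?l - 1) / real ?l \<le> real n / real (Suc n)"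
        using ne assms(3) by (simp add: field_simps)
    qed
    finally show "v \<in> cball (bary xs) ((real n / real (Suc n)) * D)" by simp
  qed
  then have "convex hull set xs \<subseteq> cball (bary xs) ((real n / real (Suc n)) * D)"
    by (rule hull_minimal) simp
  then show ?thesis using y by auto
qed

lemma sd_bary_cong:
  assumes "length xs \<le> Suc n"
    and D: "\<And>u v. u \<in> set xs \<Longrightarrow> v \<in> set xs \<Longrightarrow> dist u v \<le> D"
    and eq: "\<And>zs. length zs = length xs \<Longrightarrow> set zs \<subseteq> convex hull set xs \<Longrightarrow>
      (\<And>u v. u \<in> set zs \<Longrightarrow> v \<in> set zs \<Longrightarrow> dist u v \<le> (real n / real (Suc n)) * D) \<Longrightarrow> f zs = g zs"
  shows "sd bary f xs = sd bary g xs"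
proof -
  define P where "P = (\<lambda>xs zs :: 'a list. length zs = length xs \<and> set zs \<subseteq> convex hull set xs \<and>
    (\<forall>D. (\<forall>u\<in>set xs. \<forall>v\<in>set xs. dist u v \<le> D) \<longrightarrow>
      (\<forall>u\<in>set zs. \<forall>v\<in>set zs. dist u v \<le> (real n / real (Suc n)) * D)))"
  show ?thesis
  proof (rule sd_cong[where R = "\<lambda>xs. length xs \<le> Suc n" and P = P])
    fix xs ys zs
    assume len: "length xs \<le> Suc n" and ys: "set ys \<subseteq> set xs" "Suc (length ys) = length xs"
      and P: "P ys zs"
    have ne: "xs \<noteq> []" using ys by auto
    have b: "bary xs \<in> convex hull set xs" by (rule bary_in_convex_hull[OF ne])
    have zs: "set zs \<subseteq> convex hull set xs"
      using P hull_mono[OF ys(1), of convex] by (auto simp: P_def)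
    have "dist u v \<le> (real n / real (Suc n)) * D"
      if D: "\<forall>u\<in>set xs. \<forall>v\<in>set xs. dist u v \<le> D"
        and uv: "u \<in> set (bary xs # zs)" "v \<in> set (bary xs # zs)" for D u v
    proof -
      have *: "dist (bary xs) y \<le> (real n / real (Suc n)) * D" if "y \<in> set (bary xs # zs)" for y
        by (rule dist_bary_le) (use D len b zs that in auto)
      have "dist u v \<le> (real n / real (Suc n)) * D" if "u \<in> set zs" "v \<in> set zs"
        using P D that ys(1) unfolding P_def by blast
      then show ?thesis using uv *[OF uv(1)] *[OF uv(2)] by (auto simp: dist_commute)
    qed
    then show "P xs (bary xs # zs)"
      using b zs P ys unfolding P_def by (auto simp del: of_nat_Suc)
  next
    fix zs assume "P xs zs"
    then show "f zs = g zs" using eq D unfolding P_def by blast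
  qed (use assms in \<open>auto simp: P_def\<close>)
qed

definition sdi :: "nat \<Rightarrow> ('a::real_normed_vector list \<Rightarrow> 'r::comm_ring_1) \<Rightarrow> 'a list \<Rightarrow> 'r" where
  "sdi r = sd bary ^^ r"

lemma sdi_0 [simp]: "sdi 0 f = f" and sdi_Suc: "sdi (Suc r) f = sd bary (sdi r f)"
  by (simp_all add: sdi_def)

lemma sdi_cong:
  assumes "length xs \<le> Suc n"
    and "\<And>u v. u \<in> set xs \<Longrightarrow> v \<in> set xs \<Longrightarrow> dist u v \<le> D"
    and "\<And>zs. length zs = length xs \<Longrightarrow> set zs \<subseteq> convex hull set xs \<Longrightarrow>
      (\<And>u v. u \<in> set zs \<Longrightarrow> v \<in> set zs \<Longrightarrow> dist u v \<le> (real n / real (Suc n)) ^ r * D) \<Longrightarrow> f zs = g zs"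
  shows "sdi r f xs = sdi r g xs"
  using assms
proof (induction r arbitrary: xs D)
  case 0
  show ?case unfolding sdi_0 by (rule "0.prems"(3)) (use 0 in \<open>auto intro: hull_inc\<close>)
next
  case (Suc r)
  show ?case unfolding sdi_Suc
  proof (rule sd_bary_cong[OF Suc.prems(1,2)])
    fix zs :: "'a list"
    assume zs: "length zs = length xs" "set zs \<subseteq> convex hull set xs"
      "\<And>u v. u \<in> set zs \<Longrightarrow> v \<in> set zs \<Longrightarrow> dist u v \<le> (real n / real (Suc n)) * D"
    show "sdi r f zs = sdi r g zs"
    proof (rule Suc.IH[OF _ zs(3)])
      fix ws assume "length ws = length zs" "set ws \<subseteq> convex hull set zs"
        "\<And>u v. u \<in> set ws \<Longrightarrow> v \<in> set ws \<Longrightarrow>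
          dist u v \<le> (real n / real (Suc n)) ^ r * ((real n / real (Suc n)) * D)"
      moreover have "convex hull set zs \<subseteq> convex hull set xs"
        using zs(2) by (simp add: hull_minimal)
      ultimately show "f ws = g ws"
        using zs(1) by (intro Suc.prems(3)) (auto simp: mult_ac simp del: of_nat_Suc)
    qed (use zs Suc.prems in auto)
  qed auto
qed

lemma sdi_Nil [simp]: "sdi r f [] = f []"
  by (induction r) (simp_all add: sdi_Suc)

lemma sdi_diff: "sdi r (\<lambda>ys. f ys - g ys) xs = sdi r f xs - sdi r g xs"
proof (induction r arbitrary: xs)
  case (Suc r)
  have "sdi r (\<lambda>ys. f ys - g ys) = (\<lambda>xs. sdi r f xs - sdi r g xs)" by (rule ext) (rule Suc)
  then show ?case by (simp add: sdi_Suc sd_diff)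
qed simp

lemma sdi_sum: "sdi r (\<lambda>ys. \<Sum>i\<in>A. f i ys) xs = (\<Sum>i\<in>A. sdi r (f i) xs)"
proof (induction r arbitrary: xs)
  case (Suc r)
  have "sdi r (\<lambda>ys. \<Sum>i\<in>A. f i ys) = (\<lambda>xs. \<Sum>i\<in>A. sdi r (f i) xs)" by (rule ext) (rule Suc)
  then show ?case by (simp add: sdi_Suc sd_sum)
qed simp

lemma cob_sdi: "cob (sdi r f) xs = sdi r (cob f) xs"
proof (induction r arbitrary: xs)
  case (Suc r)
  have "cob (sdi r f) = sdi r (cob f)" by (rule ext) (rule Suc)
  then show ?case by (simp add: sdi_Suc cob_sd)
qed simp

lemma sdi_map:
  fixes g :: "'a::real_normed_vector \<Rightarrow> 'a"
  assumes "linear g"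
  shows "sdi r f (map g xs) = sdi r (\<lambda>ys. f (map g ys)) xs"
proof (induction r arbitrary: xs)
  case (Suc r)
  have "sdi r (\<lambda>ys. f (map g ys)) = (\<lambda>ys. sdi r f (map g ys))" by (rule ext) (rule Suc[symmetric])
  moreover have "sd bary (sdi r f) (map g xs) = sd bary (\<lambda>ys. sdi r f (map g ys)) xs"
    by (rule sd_map[where R = "\<lambda>_. True" and h = g]) (simp_all add: bary_map assms)
  ultimately show ?case by (simp add: sdi_Suc)
qed simp

section \<open>The polytope and its boundary\<close>

lemma linear_shift: "linear (shift :: real^'n^('p::nontriv mod_ring) \<Rightarrow> _)"
  by (rule linearI) (auto simp: shift_def vec_eq_iff)

lemma shift_pow: "(shift ^^ m) v = (\<chi> k. v $ (k - of_nat m))"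
  by (induction m) (auto simp: shift_def vec_eq_iff algebra_simps)

lemma shift_pow_CARD: "(shift ^^ CARD('p)) v = v" for v :: "real^'n^('p::nontriv mod_ring)"
  by (simp add: shift_pow vec_eq_iff)

lemma inj_shift: "inj (shift :: real^'n^('p::nontriv mod_ring) \<Rightarrow> _)"
proof (rule injI)
  fix v w :: "real^'n^('p mod_ring)" assume "shift v = shift w"
  then have "shift v $ (k + 1) = shift w $ (k + 1)" for k by simp
  then show "v = w" by (simp add: shift_def vec_eq_iff)
qed

lemma dist_shift: "dist (shift v) (shift w) = dist v w" for v :: "real^'n^('p::nontriv mod_ring)"
proof -
  have "(\<Sum>k\<in>UNIV. (dist (shift v $ k) (shift w $ k))\<^sup>2) = (\<Sum>k\<in>UNIV. (dist (v $ k) (w $ k))\<^sup>2)"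
    by (rule sum.reindex_bij_witness[where i = "\<lambda>k. k + 1" and j = "\<lambda>k. k - 1"]) (auto simp: shift_def)
  then show ?thesis by (simp add: dist_vec_def L2_set_def)
qed

abbreviation evec_pair :: "'p::nontriv mod_ring \<times> 'n::finite \<Rightarrow> real^'n^('p mod_ring)" where
  "evec_pair x \<equiv> evec (fst x) (snd x)"

lemma Qpoly_eq: "(Qpoly :: (real^'n^('p::nontriv mod_ring)) set) = convex hull range evec_pair"
proof -
  have "{evec i j |i j. True} = range (evec_pair :: 'p mod_ring \<times> 'n \<Rightarrow> _)"
    by (auto simp: set_eq_iff image_iff)
  then show ?thesis by (simp add: Qpoly_def)
qed

lemma polytope_Qpoly: "polytope Qpoly"
  unfolding Qpoly_eq by (intro polytope_convex_hull) simp

lemma shift_image_evec_pair: "shift ` range evec_pair = range evec_pair"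
proof (intro equalityI subsetI)
  fix x :: "real^'n^('p::nontriv mod_ring)" assume "x \<in> range evec_pair"
  then obtain i j where "x = evec i j" by auto
  then have "x = shift (evec_pair (i - 1, j))" by (simp add: shift_evec)
  then show "x \<in> shift ` range evec_pair" by blast
next
  fix x :: "real^'n^('p::nontriv mod_ring)" assume "x \<in> shift ` range evec_pair"
  then obtain i j where "x = shift (evec i j)" by auto
  then have "x = evec_pair (i + 1, j)" by (simp add: shift_evec)
  then show "x \<in> range evec_pair" by blast
qed

lemma shift_image_Qpoly: "shift ` Qpoly = Qpoly"
  unfolding Qpoly_eq by (simp add: convex_hull_linear_image[OF linear_shift] shift_image_evec_pair)

lemma shift_image_rel_frontier: "shift ` rel_frontier Qpoly = rel_frontier Qpoly"
  unfolding rel_frontier_def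
  by (simp add: image_set_diff[OF inj_shift] closure_injective_linear_image[OF linear_shift inj_shift]
      rel_interior_injective_linear_image[OF linear_shift[unfolded linear_conv_bounded_linear] inj_shift, symmetric] shift_image_Qpoly)

lemma evec_nth: "evec i j $ k $ l = (if l = j then
    (if k = i then 1 / 2 else - 1 / (2 * (real CARD('p) - 1))) else 0)"
  for i :: "'p::nontriv mod_ring"
  using nontriv[where 'a = 'p] by (auto simp: evec_def axis_def)

lemma zero_in_Qpoly: "(0 :: real^'n^('p::nontriv mod_ring)) \<in> Qpoly"
proof -
  obtain j :: 'n where True by simp
  let ?c = "1 / real CARD('p)"
  have "(\<Sum>i\<in>UNIV. ?c *\<^sub>R (evec i j :: real^'n^('p mod_ring))) \<in> Qpoly"
    unfolding Qpoly_def by (intro convex_sum) (auto intro: hull_inc)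
  also have "(\<Sum>i\<in>UNIV. ?c *\<^sub>R (evec i j :: real^'n^('p mod_ring))) = 0"
  proof -
    have "(\<Sum>i\<in>UNIV. (evec i j :: real^'n^('p mod_ring)) $ k $ l) = 0" for k l
    proof -
      \<comment> \<open>Block \<open>k\<close> of \<open>evec i j\<close> equals block
        \<open>i\<close> of \<open>evec k j\<close>, so the sum over \<open>i\<close> becomes a sum
        over blocks.\<close>
      have "(\<Sum>i\<in>UNIV. (evec i j :: real^'n^('p mod_ring)) $ k $ l) = (\<Sum>i\<in>UNIV. evec k j $ i $ l)"
        by (intro sum.cong) (auto simp: evec_nth)
      also have "\<dots> = (\<Sum>i\<in>UNIV. evec k j $ i) $ l" by (simp add: sum_component)
      finally show ?thesis by (simp add: sum_blocks_evec)
    qed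
    then show ?thesis by (simp add: vec_eq_iff flip: scaleR_sum_right)
  qed
  finally show ?thesis .
qed

definition has_fibre :: "('a \<times> 'b) set \<Rightarrow> bool" where
  "has_fibre A \<longleftrightarrow> (\<exists>j. UNIV \<times> {j} \<subseteq> A)"

text \<open>The functional \<open>u\<close> is scaled to be \<open>1\<close> on each
  \<open>evec i j\<close> with \<open>i \<noteq> s j\<close> and negative on the omitted ones. It
  exposes a face of \<open>Qpoly\<close>, proper because it misses \<open>0\<close>.\<close>

lemma evec_hull_subset_rel_frontier:
  fixes A :: "('p::nontriv mod_ring \<times> 'n::finite) set"
  assumes "\<not> has_fibre A"
  shows "convex hull (evec_pair ` A) \<subseteq> rel_frontier Qpoly"
proof -
  have "\<forall>j. \<exists>i. (i, j) \<notin> A" using assms by (auto simp: has_fibre_def)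
  then obtain s where s: "\<And>j. (s j, j) \<notin> A" by metis
  define u :: "real^'n^('p mod_ring)" where
    "u = (\<chi> k. \<chi> l. if k = s l then - 2 * (real CARD('p) - 1) else 0)"
  have p: "real CARD('p) > 1" using nontriv[where 'a = 'p] by simp
  have u: "u \<bullet> evec i j = (if i = s j then - (real CARD('p) - 1) else 1)" for i j
  proof -
    have "u \<bullet> evec i j = (\<Sum>k\<in>UNIV. \<Sum>l\<in>UNIV. if l = j then u $ k $ j * evec i j $ k $ j else 0)"
      unfolding inner_vec_def by (intro sum.cong refl) (auto simp: evec_nth)
    also have "\<dots> = (\<Sum>k\<in>UNIV. if k = s j then - 2 * (real CARD('p) - 1) * evec i j $ s j $ j else 0)"
      by (intro sum.cong refl) (auto simp: u_def)
    also have "\<dots> = - 2 * (real CARD('p) - 1) * evec i j $ s j $ j" by simp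
    also have "\<dots> = (if i = s j then - (real CARD('p) - 1) else 1)"
      using p by (auto simp: evec_nth field_simps)
    finally show ?thesis .
  qed
  have "Qpoly \<subseteq> {x. u \<bullet> x \<le> 1}"
    unfolding Qpoly_eq using p by (intro hull_minimal convex_halfspace_le) (auto simp: u)
  then have face: "(Qpoly \<inter> {x. u \<bullet> x = 1}) face_of Qpoly"
    by (intro face_of_Int_supporting_hyperplane_le) (auto simp: Qpoly_def)
  have "0 \<notin> Qpoly \<inter> {x. u \<bullet> x = 1}" by simp
  then have "Qpoly \<inter> {x. u \<bullet> x = 1} \<noteq> Qpoly" using zero_in_Qpoly by metis
  then have "Qpoly \<inter> {x. u \<bullet> x = 1} \<subseteq> rel_frontier Qpoly"
    by (rule face_of_subset_rel_frontier[OF face])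
  moreover have "convex hull (evec_pair ` A) \<subseteq> Qpoly"
    unfolding Qpoly_eq by (intro hull_mono) auto
  moreover have "convex hull (evec_pair ` A) \<subseteq> {x. u \<bullet> x = 1}"
    using s by (intro hull_minimal convex_hyperplane) (auto simp: u)
  ultimately show ?thesis by blast
qed

text \<open>
  An element of \<open>\<int>\<^sub>p\<close> attached equivariantly to a set without full fibre: the mean of a nonempty
  proper subset of \<open>\<int>\<^sub>p\<close>, whose cardinality is invertible modulo \<open>p\<close>.
\<close>

definition block_mean :: "('p::prime_card mod_ring \<times> 'n) set \<Rightarrow> 'p mod_ring" where
  "block_mean S = (let A = {i. (i, SOME j. j \<in> snd ` S) \<in> S} in (\<Sum>i\<in>A. i) / of_nat (card A))"

lemma mem_tr_image_iff: "x \<in> tr g ` S \<longleftrightarrow> tr (- g) x \<in> S"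
  by (auto intro: rev_image_eqI)

lemma inj_tr: "inj (tr g)"
  by (rule injI) (metis (no_types, lifting) add_right_cancel fst_tr prod_eqI snd_tr)

lemma block_mean_tr:
  fixes S :: "('p::prime_card mod_ring \<times> 'n) set"
  assumes "S \<noteq> {}" "\<not> has_fibre S"
  shows "block_mean (tr 1 ` S) = block_mean S + 1"
proof -
  define j where "j = (SOME j. j \<in> snd ` S)"
  define A where "A = {i. (i, j) \<in> S}"
  \<comment> \<open>The choice of \<open>j\<close> depends only on the set of second components,
    which translation preserves, so both means use the same \<open>j\<close>.\<close>
  have "snd ` tr 1 ` S = snd ` S" by (force simp: image_image)
  then have "block_mean (tr 1 ` S) = (let A = {i. (i, j) \<in> tr 1 ` S} in (\<Sum>i\<in>A. i) / of_nat (card A))"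
    by (simp add: block_mean_def j_def)
  moreover have "{i. (i, j) \<in> tr 1 ` S} = (\<lambda>i. i + 1) ` A"
  proof (rule Set.set_eqI)
    fix i
    have "i \<in> (\<lambda>i. i + 1) ` A \<longleftrightarrow> i - 1 \<in> A" by (auto intro: rev_image_eqI)
    then show "i \<in> {i. (i, j) \<in> tr 1 ` S} \<longleftrightarrow> i \<in> (\<lambda>i. i + 1) ` A"
      by (simp add: A_def mem_tr_image_iff) (simp add: tr_def)
  qed
  ultimately have *: "block_mean (tr 1 ` S) = (\<Sum>i\<in>A. i + 1) / of_nat (card A)"
    by (simp add: Let_def sum.reindex card_image)
  have "j \<in> snd ` S" unfolding j_def using assms(1) by (metis some_in_eq image_is_empty)
  then have "A \<noteq> {}" by (auto simp: A_def)
  moreover have "A \<noteq> UNIV" using assms(2) by (auto simp: A_def has_fibre_def)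
  ultimately have "0 < card A" "card A < CARD('p)"
    using psubset_card_mono[of UNIV A] by (auto simp: card_gt_0_iff)
  then have "of_nat (card A) \<noteq> (0 :: 'p mod_ring)"
    using of_nat_0_mod_ring_dvd[of "card A", where 'a = 'p] nat_dvd_not_less by blast
  then have "block_mean (tr 1 ` S) = (\<Sum>i\<in>A. i) / of_nat (card A) + 1"
    unfolding * by (simp add: sum.distrib add_divide_distrib)
  then show ?thesis by (simp add: block_mean_def A_def j_def)
qed

lemma card_le_if_not_has_fibre:
  fixes S :: "('p::nontriv mod_ring \<times> 'n::finite) set"
  assumes "\<not> has_fibre S"
  shows "card S \<le> CARD('n) * (CARD('p) - 1)"
proof -
  have "\<forall>j. \<exists>i. (i, j) \<notin> S" using assms by (auto simp: has_fibre_def)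
  then obtain s where s: "\<And>j. (s j, j) \<notin> S" by metis
  have "card S \<le> card (UNIV - range (\<lambda>j. (s j, j)))"
    using s by (intro card_mono) auto
  also have "\<dots> = CARD('p) * CARD('n) - CARD('n)"
    by (subst card_Diff_subset) (auto simp: card_image inj_on_def)
  finally show ?thesis by (simp add: algebra_simps)
qed

text \<open>
  The chains of \<open>join_chain\<close> avoid full fibres because each second component is used for only
  \<open>p - 1\<close> consecutive cone apices.
\<close>

lemma not_has_fibre_if_blocks:
  fixes ys :: "('p::nontriv mod_ring \<times> 'n::finite) list"
  assumes en: "inj_on en {..<CARD('n)}" and k: "k < CARD('n) * (CARD('p) - 1)"
    and ys: "map snd ys = rev (map (\<lambda>i. en (i div (CARD('p) - 1))) [0..<Suc k])"
  shows "\<not> has_fibre (set ys)"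
proof
  let ?q = "CARD('p) - 1"
  assume "has_fibre (set ys)"
  then obtain j where j: "UNIV \<times> {j} \<subseteq> set ys" by (auto simp: has_fibre_def)
  have q: "?q > 0" using nontriv[where 'a = 'p] by simp
  have "(0, j) \<in> set ys" using j by auto
  then have "j \<in> set (map snd ys)" by force
  then obtain i0 where i0: "i0 \<le> k" "j = en (i0 div ?q)" unfolding ys by (auto simp: less_Suc_eq_le simp del: upt_Suc)
  have lt: "i div ?q < CARD('n)" if "i \<le> k" for i
    using that k q by (simp add: less_mult_imp_div_less)
  have "CARD('p) = card (UNIV \<times> {j} :: ('p mod_ring \<times> 'n) set)" by (simp add: card_cartesian_product)
  also have "\<dots> \<le> card (set (filter (\<lambda>x. snd x = j) ys))"
    using j by (intro card_mono) auto
  also have "\<dots> \<le> length (filter (\<lambda>x. snd x = j) ys)" by (rule card_length)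
  also have "\<dots> = length (filter (\<lambda>x. x = j) (map snd ys))" by (simp add: filter_map o_def)
  also have "\<dots> = length (filter (\<lambda>i. en (i div ?q) = j) [0..<Suc k])"
    unfolding ys by (simp add: filter_map o_def flip: rev_filter del: upt_Suc)
  also have "\<dots> = card (set (filter (\<lambda>i. en (i div ?q) = j) [0..<Suc k]))"
    by (rule distinct_card[symmetric]) simp
  also have "\<dots> \<le> card {i0 div ?q * ?q..<Suc (i0 div ?q) * ?q}"
  proof (intro card_mono subsetI)
    fix i assume "i \<in> set (filter (\<lambda>i. en (i div ?q) = j) [0..<Suc k])"
    then have "i \<le> k" "en (i div ?q) = en (i0 div ?q)"
      using i0 by (auto simp: less_Suc_eq_le simp del: upt_Suc)
    then have "i div ?q = i0 div ?q" using en lt i0 by (auto dest: inj_onD)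
    then show "i \<in> {i0 div ?q * ?q..<Suc (i0 div ?q) * ?q}"
      using q by (metis atLeastLessThan_iff div_times_less_eq_dividend dividend_less_div_times
          add.commute mult_Suc)
  qed simp
  also have "\<dots> = ?q" by simp
  finally show False using q by simp
qed

section \<open>Equivariant labellings by sets\<close>

text \<open>Separates the topological content from the triangulation, which will enter only through
  \<open>M\<close> and the scale \<open>\<delta>\<close>.\<close>

lemma no_equivariant_set_labelling:
  fixes M :: "real^'n^('p::prime_card mod_ring) \<Rightarrow> ('p mod_ring \<times> 'n) set"
  assumes ne: "\<And>y. y \<in> Qpoly \<Longrightarrow> M y \<noteq> {}"
    and "0 < \<delta>"
    and small: "\<And>Z. finite Z \<Longrightarrow> Z \<noteq> {} \<Longrightarrow> Z \<subseteq> Qpoly \<Longrightarrow>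
      (\<And>u v. u \<in> Z \<Longrightarrow> v \<in> Z \<Longrightarrow> dist u v < \<delta>) \<Longrightarrow> \<not> has_fibre (\<Union>(M ` Z))"
    and equiv: "\<And>y. y \<in> rel_frontier Qpoly \<Longrightarrow> M (shift y) = tr 1 ` M y"
  shows False
proof -
  define N where "N = CARD('n) * (CARD('p) - 1)"
  have N0: "0 < N" using nontriv[where 'a = 'p] by (simp add: N_def)
  obtain en where en: "bij_betw en {0..<CARD('n)} (UNIV :: 'n set)"
    using ex_bij_betw_nat_finite[of "UNIV :: 'n set"] by auto
  define jj where "jj i = en (i div (CARD('p) - 1))" for i
  define S where "S zs = \<Union>(M ` set zs)" for zs
  \<comment> \<open>The pairs \<open>b zs\<close> label the last subdivision: comparable sets of equal size are equal, so
    only \<open>N\<close> levels occur along a flag and every \<open>N\<close>-simplex is degenerate.\<close>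
  define b where "b zs = (block_mean (S zs), card (S zs))" for zs
  define D where "D = diameter (Qpoly :: (real^'n^('p mod_ring)) set)"
  define q where "q = real N / real (Suc N)"
  have bdd: "bounded (Qpoly :: (real^'n^('p mod_ring)) set)"
    by (simp add: polytope_Qpoly polytope_imp_bounded)
  have D: "dist u v \<le> D" if "u \<in> Qpoly" "v \<in> Qpoly" for u v :: "real^'n^('p mod_ring)"
    unfolding D_def using diameter_bounded_bound[OF bdd that] .
  have "0 \<le> D" using D[OF zero_in_Qpoly zero_in_Qpoly] by simp
  obtain r where r: "q ^ r * D < \<delta>"
  proof (cases "D = 0")
    case False
    then have "0 < D" using \<open>0 \<le> D\<close> by simp
    obtain r where "q ^ r < \<delta> / D"
      using real_arch_pow_inv[of "\<delta> / D" q] \<open>0 < D\<close> \<open>0 < \<delta>\<close> by (auto simp: q_def)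
    then show ?thesis using \<open>0 < D\<close> that by (simp add: field_simps)
  qed (use \<open>0 < \<delta>\<close> that in auto)
  define tiny where "tiny zs \<longleftrightarrow> set zs \<subseteq> Qpoly \<and> (\<forall>u\<in>set zs. \<forall>v\<in>set zs. dist u v < \<delta>)" for zs :: "(real^'n^('p mod_ring)) list"
  have tiny_cong: "sdi r f xs = sdi r g xs"
    if "set xs \<subseteq> Qpoly" "length xs \<le> Suc N"
      and eq: "\<And>zs. length zs = length xs \<Longrightarrow> set zs \<subseteq> convex hull set xs \<Longrightarrow> tiny zs \<Longrightarrow> f zs = g zs"
    for f g :: "(real^'n^('p mod_ring)) list \<Rightarrow> 'p mod_ring" and xs
  proof (rule sdi_cong[OF that(2)])
    fix zs assume zs: "length zs = length xs" "set zs \<subseteq> convex hull set xs"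
      "\<And>u v. u \<in> set zs \<Longrightarrow> v \<in> set zs \<Longrightarrow> dist u v \<le> (real N / real (Suc N)) ^ r * D"
    have "convex hull set xs \<subseteq> Qpoly" using that(1) by (intro hull_minimal) (auto simp: Qpoly_def)
    then have "tiny zs"
      using zs r unfolding tiny_def q_def by (meson order_le_less_trans subset_trans)
    then show "f zs = g zs" using zs by (intro eq)
  qed (use D that(1) in auto)
  have no_fibre: "\<not> has_fibre (S zs)" if "tiny zs" "zs \<noteq> []" for zs
    using small[of "set zs"] that by (auto simp: S_def tiny_def)
  have S_ne: "S zs \<noteq> {}" if "tiny zs" "zs \<noteq> []" for zs
    using that ne[of "hd zs"] by (cases zs) (auto simp: S_def tiny_def)
  have tiny_mono: "tiny ys" if "tiny xs" "set ys \<subseteq> set xs" for xs ys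
    using that unfolding tiny_def by blast
  have S_mono: "S ys \<subseteq> S xs" if "set ys \<subseteq> set xs" for xs ys
    using that unfolding S_def by blast

  have b_shift: "b (map shift zs) = tr 1 (b zs)"
    if "tiny zs" "zs \<noteq> []" "set zs \<subseteq> rel_frontier Qpoly" for zs
  proof -
    have "S (map shift zs) = tr 1 ` S zs"
      using that(3) equiv unfolding S_def by (force simp: image_UN)
    moreover have "card (tr 1 ` S zs) = card (S zs)"
      by (rule card_image) (use inj_tr inj_on_subset in blast)
    ultimately show ?thesis
      using block_mean_tr[OF S_ne no_fibre, OF that(1,2) that(1,2)] by (simp add: b_def tr_def)
  qed
  have sd_b_shift: "sd b f (map shift zs) = sd b (\<lambda>ws. f (map (tr 1) ws)) zs"
    if "tiny zs" "set zs \<subseteq> rel_frontier Qpoly" for f :: "('p mod_ring \<times> nat) list \<Rightarrow> 'p mod_ring" and zs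
    by (rule sd_map[where R = "\<lambda>zs. tiny zs \<and> set zs \<subseteq> rel_frontier Qpoly"])
      (use that tiny_mono b_shift in blast)+

  \<comment> \<open>The last subdivision sends the barycentre of a face \<open>zs\<close> to
    \<open>b zs\<close>, which turns the set-valued labels into a map on vertices.\<close>
  define \<Psi> where "\<Psi> f xs = sdi r (sd b f) xs" for f :: "('p mod_ring \<times> nat) list \<Rightarrow> 'p mod_ring" and xs
  define \<Phi> where "\<Phi> f ys = \<Psi> f (map evec_pair ys)" for f and ys :: "('p mod_ring \<times> 'n) list"
  have evec_Q: "set (map evec_pair ys) \<subseteq> Qpoly" for ys :: "('p mod_ring \<times> 'n) list"
    by (auto simp: Qpoly_def intro: hull_inc)
  let ?a = "univ_cochain :: ('p mod_ring \<times> nat) list \<Rightarrow> 'p mod_ring"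
  have \<Psi>_cob: "cob (\<Psi> f) xs = \<Psi> (cob f) xs" for f xs
  proof -
    have "cob (sd b f) = sd b (cob f)" by (rule ext) (rule cob_sd)
    then show ?thesis by (simp add: \<Psi>_def[abs_def] cob_sdi)
  qed

  have one: "join_chain jj k (norm_tr (\<Phi> ?a)) = 1" if "k < N" for k
  proof (rule join_chain_norm_tr_univ_cochain[OF _ _ _ _ _ _ that])
    show "\<Phi> f ys = \<Phi> g ys" if "\<And>zs. length zs = length ys \<Longrightarrow> f zs = g zs" for f g ys
    proof -
      have sdb: "sd b f zs = sd b g zs" if "length zs = length ys" for zs
        by (rule sd_cong[where R = "\<lambda>_. True" and P = "\<lambda>xs zs. length zs = length xs"])
          (use that \<open>\<And>zs. length zs = length ys \<Longrightarrow> f zs = g zs\<close> in auto)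
      show ?thesis unfolding \<Phi>_def \<Psi>_def
      proof (rule sdi_cong[where n = "length ys" and D = D])
        show "dist u v \<le> D" if "u \<in> set (map evec_pair ys)" "v \<in> set (map evec_pair ys)" for u v
          using that evec_Q[of ys] D by blast
      qed (use sdb in auto)
    qed
    show "\<Phi> (\<lambda>zs. f zs - g zs) ys = \<Phi> f ys - \<Phi> g ys" for f g ys
    proof -
      have "sd b (\<lambda>zs. f zs - g zs) = (\<lambda>xs. sd b f xs - sd b g xs)" by (rule ext) (rule sd_diff)
      then show ?thesis by (simp add: \<Phi>_def \<Psi>_def sdi_diff)
    qed
    show "\<Phi> (\<lambda>zs. \<Sum>h\<in>UNIV. f (h :: 'p mod_ring) zs) ys = (\<Sum>h\<in>UNIV. \<Phi> (f h) ys)" for f ys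
    proof -
      have "sd b (\<lambda>zs. \<Sum>h\<in>UNIV. f (h :: 'p mod_ring) zs) = (\<lambda>xs. \<Sum>h\<in>UNIV. sd b (f h) xs)"
        by (rule ext) (rule sd_sum)
      then show ?thesis by (simp add: \<Phi>_def \<Psi>_def sdi_sum)
    qed
    show "cob (\<Phi> f) ys = \<Phi> (cob f) ys" for f ys
      by (simp add: \<Phi>_def[abs_def] \<Psi>_cob flip: cob_map)
    show "\<Phi> f [] = f []" for f by (simp add: \<Phi>_def \<Psi>_def)
    show "\<Phi> f (map (tr 1) ys) = \<Phi> (\<lambda>zs. f (map (tr 1) zs)) ys"
      if ys: "map snd ys = rev (map jj [0..<Suc k])" and "k < N" for f ys k
    proof -
      let ?xs = "map evec_pair ys"
      \<comment> \<open>Equivariance of \<open>M\<close> is given on the boundary only; the choice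
        of \<open>jj\<close> keeps the simplices of \<open>h_k\<close> there.\<close>
      have "\<not> has_fibre (set ys)"
        using en that unfolding N_def jj_def
        by (intro not_has_fibre_if_blocks[of en]) (auto simp: bij_betw_def lessThan_atLeast0)
      then have bd: "convex hull set ?xs \<subseteq> rel_frontier Qpoly"
        using evec_hull_subset_rel_frontier[of "set ys"] by simp
      have len: "length ?xs = Suc k" using arg_cong[OF ys, of length] by simp
      have "map evec_pair (map (tr 1) ys) = map shift ?xs"
        by (simp add: shift_evec)
      then have "\<Phi> f (map (tr 1) ys) = sdi r (\<lambda>zs. sd b f (map shift zs)) ?xs"
        unfolding \<Phi>_def \<Psi>_def by (simp only: sdi_map[OF linear_shift])
      also have "\<dots> = sdi r (sd b (\<lambda>ws. f (map (tr 1) ws))) ?xs"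
        using len \<open>k < N\<close> bd by (intro tiny_cong evec_Q sd_b_shift) auto
      finally show ?thesis by (simp add: \<Phi>_def \<Psi>_def)
    qed
  qed

  have top: "\<Psi> (cob ?a) xs = 0" if "set xs \<subseteq> Qpoly" "length xs = Suc N" for xs
  proof -
    \<comment> \<open>Either \<open>zs\<close> already has a repetition, or there are at least as
      many labels as vertices of \<open>xs\<close>. Keeping \<open>b xs\<close> at the head lets the
      next vertex be compared with it.\<close>
    define P where "P = (\<lambda>xs (zs :: ('p mod_ring \<times> nat) list). length zs = length xs \<and>
      ((\<exists>us v ws. zs = us @ v # v # ws) \<or> length xs \<le> card (S xs) \<and> (zs \<noteq> [] \<longrightarrow> hd zs = b xs)))"
    have "sd b (cob ?a) zs = sd b (\<lambda>_. 0) zs" if zs: "tiny zs" "length zs = Suc N" for zs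
    proof (rule sd_cong[where R = tiny and P = P])
      fix xs ys zs
      assume xs: "tiny xs" and ys: "set ys \<subseteq> set xs" "Suc (length ys) = length xs" and P: "P ys zs"
      have xs_ne: "xs \<noteq> []" using ys by auto
      consider us v ws where "zs = us @ v # v # ws"
        | "length ys \<le> card (S ys)" "zs \<noteq> [] \<longrightarrow> hd zs = b ys"
        using P unfolding P_def by blast
      then show "P xs (b xs # zs)"
      proof cases
        case 1
        then have "b xs # zs = (b xs # us) @ v # v # ws" by simp
        then show ?thesis using P ys unfolding P_def by (metis length_Cons)
      next
        case 2
        show ?thesis
        proof (cases "length xs \<le> card (S xs)")
          case True
          then show ?thesis using P ys unfolding P_def by auto
        next
          case False
          \<comment> \<open>With fewer labels than vertices in \<open>xs\<close>, the label set
            cannot have grown from \<open>ys\<close> to \<open>xs\<close>, so the new vertex repeats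
            the previous one.\<close>
          have "card (S ys) \<le> card (S xs)" using S_mono[OF ys(1)] by (intro card_mono) auto
          then have "card (S ys) = card (S xs)" using False 2 ys by simp
          then have "S ys = S xs" using S_mono[OF ys(1)] by (intro card_subset_eq) auto
          then have beq: "b ys = b xs" by (simp add: b_def)
          have "0 < card (S xs)" using S_ne[OF xs xs_ne] by (simp add: card_gt_0_iff)
          then have "ys \<noteq> []" using False ys(2) by (cases ys) auto
          then obtain z zs' where z: "zs = z # zs'" using P by (cases zs) (auto simp: P_def)
          then have "b xs # zs = [] @ b xs # b xs # zs'" using 2 beq by simp
          then show ?thesis using P ys unfolding P_def by (metis length_Cons)
        qed
      qed
    next
      fix ws assume P: "P zs ws"
      have "card (S zs) \<le> N"
        unfolding N_def using zs by (intro card_le_if_not_has_fibre no_fibre) auto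
      then obtain us v ws' where "ws = us @ v # v # ws'" using P zs by (auto simp: P_def)
      then show "cob ?a ws = 0" by (simp only: cob_univ_cochain_adjacent_eq)
    qed (use zs tiny_mono in \<open>auto simp: P_def\<close>)
    then have "\<Psi> (cob ?a) xs = sdi r (sd b (\<lambda>_. 0)) xs"
      unfolding \<Psi>_def using that by (intro tiny_cong) auto
    also have "\<dots> = 0"
    proof -
      have "sd b (\<lambda>_. 0 :: 'p mod_ring) = (\<lambda>_. 0)"
        using sd_diff[of b "\<lambda>_. 0 :: 'p mod_ring" "\<lambda>_. 0"] by auto
      then show ?thesis using sdi_diff[of r "\<lambda>_. 0 :: 'p mod_ring" "\<lambda>_. 0"] by simp
    qed
    finally show ?thesis .
  qed

  define k where "k = N - 1"
  have k: "k < N" "Suc k = N" using N0 by (auto simp: k_def)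
  \<comment> \<open>The cone from the centre \<open>0\<close>. By \<open>top\<close> its simplices
    contribute nothing, so on lists of length \<open>N\<close> the cochain \<open>\<Phi> ?a\<close>
    is the coboundary of \<open>?g\<close> and vanishes on the cycle formed by the norm of
    \<open>h_(N-1)\<close>.\<close>
  let ?g = "\<lambda>ys :: ('p mod_ring \<times> 'n) list. \<Psi> ?a (0 # map evec_pair ys)"
  have cone: "\<Phi> ?a ys = cob ?g ys" if "length ys = N" for ys
  proof -
    have "0 = cob (\<Psi> ?a) (0 # map evec_pair ys)"
      unfolding \<Psi>_cob using zero_in_Qpoly evec_Q that by (intro top[symmetric]) auto
    also have "\<dots> = \<Phi> ?a ys - cob ?g ys" by (simp add: \<Phi>_def cob_map)
    finally show ?thesis by simp
  qed
  have "join_chain jj k (norm_tr (\<Phi> ?a)) = join_chain jj k (cob (norm_tr ?g))"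
  proof (rule join_chain_cong)
    fix ys :: "('p mod_ring \<times> 'n) list" assume ys: "map snd ys = rev (map jj [0..<Suc k])"
    have "length ys = N" using arg_cong[OF ys, of length] k by simp
    then show "norm_tr (\<Phi> ?a) ys = cob (norm_tr ?g) ys"
      unfolding cob_norm_tr by (simp add: norm_tr_def cone)
  qed
  then show False using one[OF k(1)] by (simp add: join_chain_cob_norm_tr)
qed

section \<open>Triangulations\<close>

text \<open>Closure under faces puts \<open>{v}\<close> into \<open>T\<close>, and simplices of
  \<open>T\<close> meet in common faces.\<close>

lemma vertex_of_simplicial_complex:
  assumes "simplicial_complex T" "\<sigma>' \<in> T" "v \<in> vertices \<sigma>'" "\<sigma> \<in> T" "v \<in> \<sigma>"
  shows "v \<in> vertices \<sigma>"
proof -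
  have "{v} face_of \<sigma>'" using assms(3) by (simp add: vertices_def face_of_singleton)
  then have "{v} \<in> T" using assms(1,2) unfolding simplicial_complex_def by blast
  then have "\<sigma> \<inter> {v} face_of \<sigma>" using assms(1,4) unfolding simplicial_complex_def by blast
  moreover have "\<sigma> \<inter> {v} = {v}" using assms(5) by auto
  ultimately show ?thesis by (simp add: vertices_def face_of_singleton)
qed

text \<open>A minimal simplex through \<open>z\<close> lies in every simplex through
  \<open>z\<close>, since \<open>T\<close> is closed under such intersections; any of its vertices
  has \<open>z\<close> in its open star.\<close>

lemma simplicial_complex_carrier_vertex:
  assumes T: "simplicial_complex T" and z: "z \<in> \<Union>T"
  obtains \<sigma> v where "\<sigma> \<in> T" "v \<in> vertices \<sigma>" "\<And>\<tau>. \<tau> \<in> T \<Longrightarrow> z \<in> \<tau> \<Longrightarrow> v \<in> \<tau>"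
proof -
  have "finite {\<sigma> \<in> T. z \<in> \<sigma>}" "{\<sigma> \<in> T. z \<in> \<sigma>} \<noteq> {}"
    using T z by (auto simp: simplicial_complex_def)
  then obtain \<sigma> where \<sigma>: "\<sigma> \<in> T" "z \<in> \<sigma>" and min: "\<And>\<tau>. \<tau> \<in> T \<Longrightarrow> z \<in> \<tau> \<Longrightarrow> \<tau> \<subseteq> \<sigma> \<Longrightarrow> \<tau> = \<sigma>"
    using finite_has_minimal[of "{\<sigma> \<in> T. z \<in> \<sigma>}"] by auto
  obtain n where "n simplex \<sigma>" using T \<sigma> by (auto simp: simplicial_complex_def)
  then obtain v where v: "v extreme_point_of \<sigma>"
    using extreme_point_exists_convex[of \<sigma>] \<sigma> by (metis compact_simplex convex_simplex empty_iff)
  show ?thesis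
  proof
    show "v \<in> vertices \<sigma>" using v by (simp add: vertices_def)
    fix \<tau> assume \<tau>: "\<tau> \<in> T" "z \<in> \<tau>"
    then have "\<sigma> \<inter> \<tau> \<in> T" using T \<sigma>(1) unfolding simplicial_complex_def by blast
    then have "\<sigma> \<inter> \<tau> = \<sigma>" using min \<tau> \<sigma> by auto
    then show "v \<in> \<tau>" using v by (auto simp: extreme_point_of_def)
  qed (rule \<sigma>)
qed

text \<open>One vertex is chosen for each label in \<open>B\<close>, and the chosen vertices span a
  face. Applied to a full fibre, this yields the simplex sought.\<close>

lemma simplicial_complex_fibre_face:
  fixes T :: "'a::euclidean_space set set"
  assumes T: "simplicial_complex T" and \<sigma>: "\<sigma> \<in> T" and B: "B \<subseteq> lab ` vertices \<sigma>"
  shows "\<exists>\<tau>\<in>T. (int (card B) - 1) simplex \<tau> \<and> lab ` vertices \<tau> = B"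
proof -
  obtain C where C: "\<not> affine_dependent C" "\<sigma> = convex hull C"
    using T \<sigma> by (auto simp: simplicial_complex_def simplex_def)
  have "vertices \<sigma> = C"
    using extreme_point_of_convex_hull_affine_independent[OF C(1)] by (auto simp: vertices_def C(2))
  then obtain W where W: "W \<subseteq> C" "inj_on lab W" "B = lab ` W"
    using B subset_image_inj by metis
  have indep: "\<not> affine_dependent W" using C(1) W(1) affine_dependent_subset by blast
  have "convex hull W face_of \<sigma>"
    unfolding C(2) using face_of_convex_hull_affine_independent[OF C(1)] W(1) by blast
  then have "convex hull W \<in> T" using T \<sigma> unfolding simplicial_complex_def by blast
  moreover have "(int (card B) - 1) simplex convex hull W"
    using indep W by (intro simplex_convex_hull) (simp add: card_image)
  moreover have "vertices (convex hull W) = W"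
    using extreme_point_of_convex_hull_affine_independent[OF indep] by (auto simp: vertices_def)
  ultimately show ?thesis using W(3) by metis
qed

theorem mainTheorem9:
  fixes T :: "(real^'n^('p::prime_card mod_ring)) set set"
    and lab :: "real^'n^('p mod_ring) \<Rightarrow> 'p mod_ring \<times> 'n"
  assumes "nice_triangulation T"
    and "\<And>x. x \<in> (\<Union>\<sigma>\<in>T. vertices \<sigma>) \<Longrightarrow> x \<in> rel_frontier Qpoly \<Longrightarrow>
           lab (shift x) = (fst (lab x) + 1, snd (lab x))"
  shows "\<exists>\<sigma>\<in>T. \<exists>j. (int CARD('p) - 1) simplex \<sigma> \<and> lab ` vertices \<sigma> = UNIV \<times> {j}"
proof (rule ccontr)
  assume contr: "\<not> ?thesis"
  have T: "simplicial_complex T" and UT: "\<Union>T = Qpoly"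
    and shT: "\<And>\<sigma>. \<sigma> \<in> T \<Longrightarrow> \<sigma> \<subseteq> rel_frontier Qpoly \<Longrightarrow> shift ` \<sigma> \<in> T"
    using assms(1) unfolding nice_triangulation_def by blast+
  have finT: "finite T" using T by (simp add: simplicial_complex_def)
  have frQ: "rel_frontier Qpoly \<subseteq> (Qpoly :: (real^'n^('p mod_ring)) set)"
    by (simp add: polytope_Qpoly polytope_imp_closed rel_frontier_def)
  have no_fibre: "\<not> has_fibre (lab ` vertices \<sigma>)" if \<sigma>: "\<sigma> \<in> T" for \<sigma>
  proof
    assume "has_fibre (lab ` vertices \<sigma>)"
    then obtain j where "UNIV \<times> {j} \<subseteq> lab ` vertices \<sigma>" by (auto simp: has_fibre_def)
    then have "\<exists>\<tau>\<in>T. (int (card (UNIV \<times> {j} :: ('p mod_ring \<times> 'n) set)) - 1) simplex \<tau> \<and>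
        lab ` vertices \<tau> = UNIV \<times> {j}"
      by (rule simplicial_complex_fibre_face[OF T \<sigma>])
    moreover have "card (UNIV \<times> {j} :: ('p mod_ring \<times> 'n) set) = CARD('p)"
      by (simp add: card_cartesian_product)
    ultimately show False using contr by metis
  qed

  define V where "V = (\<Union>\<sigma>\<in>T. vertices \<sigma>)"
  \<comment> \<open>Inside \<open>Qpoly\<close> the complement of \<open>off v\<close> is the open
    star of \<open>v\<close>. These stars cover \<open>Qpoly\<close>, and \<open>\<delta>\<close>
    below is a Lebesgue number of the cover.\<close>
  define off where "off v = \<Union>{\<sigma> \<in> T. v \<notin> \<sigma>}" for v
  have closed_off: "closed (off v)" for v
    unfolding off_def
  proof (intro closed_Union ballI)
    show "closed \<sigma>" if "\<sigma> \<in> {\<sigma> \<in> T. v \<notin> \<sigma>}" for \<sigma>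
      using T that closed_simplex unfolding simplicial_complex_def by blast
  qed (use finT in simp)
  have "\<exists>v\<in>V. z \<notin> off v" if z: "z \<in> Qpoly" for z
  proof -
    obtain \<sigma> v where "\<sigma> \<in> T" "v \<in> vertices \<sigma>" "\<And>\<tau>. \<tau> \<in> T \<Longrightarrow> z \<in> \<tau> \<Longrightarrow> v \<in> \<tau>"
      by (rule simplicial_complex_carrier_vertex[OF T, of z]) (use z UT in auto)
    then show ?thesis unfolding V_def off_def by blast
  qed
  then have "Qpoly \<subseteq> \<Union>((\<lambda>v. - off v) ` V)" by blast
  then obtain \<delta> where \<delta>: "0 < \<delta>" "\<And>z. z \<in> Qpoly \<Longrightarrow> \<exists>v\<in>V. ball z \<delta> \<inter> off v = {}"
  proof (rule Heine_Borel_lemma[OF polytope_imp_compact[OF polytope_Qpoly]])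
    show "open G" if "G \<in> (\<lambda>v. - off v) ` V" for G using that closed_off by auto
  qed blast

  define reg where "reg y = (if y \<in> rel_frontier Qpoly then rel_frontier Qpoly else Qpoly :: (real^'n^('p mod_ring)) set)"
    for y :: "real^'n^('p mod_ring)"
  \<comment> \<open>Stars of interior simplices are not \<open>shift\<close>-invariant, so near a boundary point only the
    boundary is inspected.\<close>
  define M where "M y = {lab v |v. v \<in> V \<and> ball y \<delta> \<inter> reg y \<inter> off v = {}}" for y
  have tr_lab: "lab (shift v) = tr 1 (lab v)" if "v \<in> V" "v \<in> rel_frontier Qpoly" for v
    using assms(2)[of v] that by (simp add: V_def tr_def)
  \<comment> \<open>The boundary is the union of the proper faces of \<open>Qpoly\<close>, and each
    of them meets \<open>\<sigma>\<close> in a face of \<open>\<sigma>\<close>.\<close>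
  have frontier_face: "\<exists>\<tau>\<in>T. z \<in> \<tau> \<and> \<tau> \<subseteq> \<sigma> \<and> \<tau> \<subseteq> rel_frontier Qpoly"
    if asm: "\<sigma> \<in> T" "z \<in> \<sigma>" "z \<in> rel_frontier Qpoly" for z \<sigma>
  proof -
    obtain G where G: "G face_of Qpoly" "G \<noteq> Qpoly" "z \<in> G"
      using asm(3) rel_frontier_of_polyhedron_alt[OF polytope_imp_polyhedron[OF polytope_Qpoly]] by blast
    obtain n where "n simplex \<sigma>" using T asm(1) by (auto simp: simplicial_complex_def)
    then have "(G \<inter> \<sigma>) face_of (Qpoly \<inter> \<sigma>)" by (intro face_of_slice G convex_simplex)
    moreover have "Qpoly \<inter> \<sigma> = \<sigma>" using asm(1) UT by blast
    ultimately have "G \<inter> \<sigma> \<in> T" using T asm(1) unfolding simplicial_complex_def by metis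
    moreover have "G \<subseteq> rel_frontier Qpoly" by (rule face_of_subset_rel_frontier[OF G(1,2)])
    ultimately show ?thesis using asm G(3) by blast
  qed
  have shT_pow: "(shift ^^ m) ` \<sigma> \<in> T \<and> (shift ^^ m) ` \<sigma> \<subseteq> rel_frontier Qpoly"
    if "\<sigma> \<in> T" "\<sigma> \<subseteq> rel_frontier Qpoly" for \<sigma> m
  proof (induction m)
    case (Suc m)
    have eq: "(shift ^^ Suc m) ` \<sigma> = shift ` (shift ^^ m) ` \<sigma>" by (simp add: image_comp)
    have "shift ` (shift ^^ m) ` \<sigma> \<subseteq> shift ` rel_frontier Qpoly" using Suc by (intro image_mono) blast
    then show ?case unfolding eq shift_image_rel_frontier using Suc shT by blast
  qed (use that in simp)
  have M_shift_le: "tr 1 ` M y \<subseteq> M (shift y)" if y: "y \<in> rel_frontier Qpoly" for y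
  proof
    fix x assume "x \<in> tr 1 ` M y"
    then obtain v where v: "v \<in> V" "ball y \<delta> \<inter> rel_frontier Qpoly \<inter> off v = {}" "x = tr 1 (lab v)"
      using y by (auto simp: M_def reg_def)
    have "y \<notin> off v" using v(2) y centre_in_ball[of y \<delta>] \<delta>(1) by blast
    obtain \<sigma>' where "\<sigma>' \<in> T" "y \<in> \<sigma>'" using y frQ UT by blast
    then obtain \<sigma> where \<sigma>: "\<sigma> \<in> T" "y \<in> \<sigma>" "\<sigma> \<subseteq> rel_frontier Qpoly"
      using frontier_face[OF _ _ y] by blast
    then have "v \<in> \<sigma>" using \<open>y \<notin> off v\<close> by (auto simp: off_def)
    have v\<sigma>: "v \<in> vertices \<sigma>"
      using v(1) vertex_of_simplicial_complex[OF T _ _ \<sigma>(1) \<open>v \<in> \<sigma>\<close>] unfolding V_def by blast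
    have "{v} face_of \<sigma>" using v\<sigma> by (simp add: vertices_def face_of_singleton)
    then have "{v} \<in> T" using T \<sigma>(1) unfolding simplicial_complex_def by blast
    then have "shift ` {v} \<in> T" using shT \<sigma>(3) \<open>v \<in> \<sigma>\<close> by blast
    then have sv: "shift v \<in> V"
      unfolding V_def by (intro UN_I[of "{shift v}"]) (auto simp: vertices_def)
    have "z \<notin> off (shift v)" if z: "z \<in> ball (shift y) \<delta>" "z \<in> rel_frontier Qpoly" for z
    proof
      assume "z \<in> off (shift v)"
      then obtain \<tau>' where \<tau>': "\<tau>' \<in> T" "z \<in> \<tau>'" "shift v \<notin> \<tau>'" unfolding off_def by blast
      obtain \<tau> where \<tau>: "\<tau> \<in> T" "z \<in> \<tau>" "\<tau> \<subseteq> rel_frontier Qpoly" "shift v \<notin> \<tau>"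
        using frontier_face[OF \<tau>'(1,2) z(2)] \<tau>'(3) by blast
      obtain w where w: "z = shift w" "w \<in> rel_frontier Qpoly"
        using z(2) shift_image_rel_frontier[where 'a = 'n and 'b = 'p] by blast
      \<comment> \<open>This power inverts \<open>shift\<close>, and iterating niceness keeps
        boundary simplices in \<open>T\<close>. It carries a simplex near \<open>shift y\<close>
        missing \<open>shift v\<close> back to one near \<open>y\<close> missing
        \<open>v\<close>.\<close>
      let ?s = "(shift :: real^'n^('p mod_ring) \<Rightarrow> _) ^^ (CARD('p) - 1)"
      have "Suc (CARD('p) - 1) = CARD('p)" using nontriv[where 'a = 'p] by simp
      then have pow: "(shift ^^ Suc (CARD('p) - 1)) u = u" for u :: "real^'n^('p mod_ring)"
        using shift_pow_CARD[of u] by simp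
      have inv: "shift (?s u) = u" "?s (shift u) = u" for u
        using pow[of u] by (simp_all only: funpow.simps(2) o_apply)
          (simp only: funpow_swap1)
      have "w \<in> ?s ` \<tau>" using \<tau>(2) inv(2)[of w] unfolding w(1) by (rule rev_image_eqI[OF _ sym])
      moreover have "v \<notin> ?s ` \<tau>"
      proof
        assume "v \<in> ?s ` \<tau>"
        then obtain u where "u \<in> \<tau>" "v = ?s u" by blast
        then show False using \<tau>(4) inv(1)[of u] by simp
      qed
      moreover have "?s ` \<tau> \<in> T" using shT_pow[OF \<tau>(1,3)] by blast
      ultimately have "w \<in> off v" unfolding off_def by blast
      moreover have "w \<in> ball y \<delta>" using z(1) by (simp add: w(1) dist_shift)
      ultimately show False using v(2) w(2) by blast
    qed
    moreover have "shift y \<in> rel_frontier Qpoly" using y shift_image_rel_frontier by blast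
    moreover have "v \<in> rel_frontier Qpoly" using \<sigma>(3) \<open>v \<in> \<sigma>\<close> by blast
    then have "x = lab (shift v)" using tr_lab[OF v(1)] v(3) by simp
    ultimately show "x \<in> M (shift y)" using sv unfolding M_def reg_def by auto
  qed
  show False
  proof (rule no_equivariant_set_labelling[where M = M and \<delta> = \<delta>])
    show "M y \<noteq> {}" if "y \<in> Qpoly" for y
    proof -
      obtain v where "v \<in> V" "ball y \<delta> \<inter> off v = {}" using \<delta>(2)[OF \<open>y \<in> Qpoly\<close>] by blast
      then have "lab v \<in> M y" unfolding M_def by blast
      then show ?thesis by blast
    qed
    show "\<not> has_fibre (\<Union>(M ` Z))"
      if Z: "finite Z" "Z \<noteq> {}" "Z \<subseteq> Qpoly" and d: "\<And>u v. u \<in> Z \<Longrightarrow> v \<in> Z \<Longrightarrow> dist u v < \<delta>" for Z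
    proof -
      \<comment> \<open>A boundary point is preferred if \<open>Z\<close> has one, so that
        \<open>y\<close> lies in \<open>reg u\<close> for all \<open>u\<close> in \<open>Z\<close>;
        then any simplex through \<open>y\<close> carries all the labels.\<close>
      obtain y where y: "y \<in> Z" "Z \<inter> rel_frontier Qpoly \<noteq> {} \<longrightarrow> y \<in> rel_frontier Qpoly"
        using Z(2) by blast
      then have y_reg: "y \<in> reg u" if "u \<in> Z" for u
        using that Z(3) unfolding reg_def by (cases "u \<in> rel_frontier Qpoly") auto
      obtain \<sigma> where \<sigma>: "\<sigma> \<in> T" "y \<in> \<sigma>" using y(1) Z(3) UT by blast
      have "\<Union>(M ` Z) \<subseteq> lab ` vertices \<sigma>"
      proof
        fix x assume "x \<in> \<Union>(M ` Z)"
        then obtain u v where uv: "u \<in> Z" "v \<in> V" "ball u \<delta> \<inter> reg u \<inter> off v = {}" "x = lab v"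
          by (auto simp: M_def)
        have "y \<in> ball u \<delta>" using d[OF uv(1) y(1)] by simp
        then have "y \<notin> off v" using uv(3) y_reg[OF uv(1)] by blast
        then have "v \<in> \<sigma>" using \<sigma> by (auto simp: off_def)
        then have "v \<in> vertices \<sigma>"
          using uv(2) vertex_of_simplicial_complex[OF T _ _ \<sigma>(1)] unfolding V_def by blast
        then show "x \<in> lab ` vertices \<sigma>" using uv(4) by blast
      qed
      then show ?thesis using no_fibre[OF \<sigma>(1)] unfolding has_fibre_def by blast
    qed
    show "M (shift y) = tr 1 ` M y" if y: "y \<in> rel_frontier Qpoly" for y
    proof -
      \<comment> \<open>By \<open>M_shift_le\<close> cardinalities cannot drop along the orbit of
        \<open>y\<close>, which closes after \<open>p\<close> steps; so they are constant and the
        inclusion is an equality.\<close>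
      have fr: "(shift ^^ m) y \<in> rel_frontier Qpoly" for m
      proof (induction m)
        case (Suc m)
        then show ?case using shift_image_rel_frontier by auto
      qed (use y in simp)
      have card_tr: "card (tr 1 ` A) = card A" for A :: "('p mod_ring \<times> 'n) set"
        by (rule card_image) (use inj_tr inj_on_subset in blast)
      have le: "card (M u) \<le> card (M (shift u))" if "u \<in> rel_frontier Qpoly" for u
        using card_mono[OF _ M_shift_le[OF that]] card_tr by simp
      have "card (M (shift y)) \<le> card (M ((shift ^^ Suc m) y))" for m
      proof (induction m)
        case (Suc m)
        then show ?case using le[OF fr, of "Suc m"] by simp
      qed simp
      from this[of "CARD('p) - 1"] have "card (M (shift y)) \<le> card (M y)"
        using nontriv[where 'a = 'p] shift_pow_CARD[of y] by (simp del: funpow.simps)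
      then show ?thesis
        using M_shift_le[OF y] card_tr by (intro card_seteq[symmetric]) auto
    qed
  qed (rule \<delta>(1))
qed

end
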